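(* Let $K\subset\mathbb{R}^2$ be a compact strictly convex set of constant width and area $F$ bounded by a curve $\Gamma=\partial K$ of class $\mathcal{C}^2$ and length $L$. Let $F_e$ be the area with multiplicities enclosed by the evolute of $\Gamma$, let $\Delta=L^2-4\pi F$, and let $A$ be the area enclosed by the pedal curve associated to $K$ with respect to its Steiner point. Then $$\pi|F_e|-\Delta\ \ge\ \frac{40}{9}\pi(A-F).$$ Equality holds if and only if $K$ is a disk or it is bounded by a curve parallel to a Steiner curve.
   Context: Let $p(\varphi)=\sup\{\langle x,(\cos\varphi,\sin\varphi)\rangle : x\in K\}$ be the ($2\pi$-periodic) support function of $K$. "Strictly convex set bounded by a curve of class $\mathcal{C}^2$" means that $p$ is of class $\mathcal{C}^2$ and $p(\varphi)+p''(\varphi)>0$ for every $\varphi$. Constant width means that $p(\varphi)+p(\varphi+\pi)$ is constant. With $N(\varphi)=(\cos\varphi,\sin\varphi)$ the boundary is $\gamma(\varphi)=p(\varphi)N(\varphi)+p'(\varphi)N'(\varphi)$, with $L=\int_0^{2\pi}p\,d\varphi$ and $F=\frac12\int_0^{2\pi}(p^2-p'^2)\,d\varphi$. The evolute of $\Gamma$ is the envelope of its normal lines, $\tilde\gamma=\gamma-(p+p'')N$; it is the envelope of the lines $x\cos t+y\sin t=f(t)$ with $f(t)=p'(t-\pi/2)$. The area with multiplicities of the curve enveloped by a family $x\cos t+y\sin t=f(t)$, with $f$ $2\pi$-periodic, is $\frac12\int_0^{2\pi}(f^2-f'^2)\,dt$. Thus $F_e=\frac12\int_0^{2\pi}(p'^2-p''^2)\,d\varphi\le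 0$. The Steiner point of $K$ is $s(K)=\frac1\pi\int_0^{2\pi}p(\varphi)N(\varphi)\,d\varphi=(s_1,s_2)$. The support function of $K$ with respect to the Steiner point as origin is $p_s(\varphi)=p(\varphi)-s_1\cos\varphi-s_2\sin\varphi$. The pedal curve of $K$ with respect to its Steiner point is the curve given in polar coordinates centered at $s(K)$ by $r=p_s(\varphi)$; the area it encloses is $A=\frac12\int_0^{2\pi}p_s(\varphi)^2\,d\varphi$. A $\mathcal{C}^2$ function $f$ is the generalized support function of the (possibly non-convex) curve enveloped by the lines $x\cos t+y\sin t=f(t)$. The parallel curve at distance $c$ has generalized support function $f+c$. A Steiner curve (deltoid) is the hypocycloid of three cusps; a curve parallel to a Steiner curve (at distance $c\in\mathbb{R}$) is one with generalized support function $c+a\cos\varphi+b\sin\varphi+B\sin(3(\varphi-\varphi_0))$, where $B>0$ and $a,b,\varphi_0\in\mathbb{R}$. *)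

theory Defs
  imports "HOL-Analysis.Analysis"
begin

definition unit_normal :: "real \<Rightarrow> real^2" where
  "unit_normal t = vector [cos t, sin t]"

definition unit_tangent :: "real \<Rightarrow> real^2" where
  "unit_tangent t = vector [- sin t, cos t]"

definition support_fun :: "(real^2) set \<Rightarrow> real \<Rightarrow> real" where
  "support_fun K t = Sup ((\<lambda>x. x \<bullet> unit_normal t) ` K)"

definition C2_fun :: "(real \<Rightarrow> real) \<Rightarrow> bool" where
  "C2_fun f \<longleftrightarrow> f C1_differentiable_on UNIV \<and> deriv f C1_differentiable_on UNIV"

text \<open>A compact strictly convex set bounded by a curve of class C2, in the sense that the
  support function \<open>p\<close> is of class C2 with \<open>p + p'' > 0\<close>.  Convexity and nonemptiness are
  required separately: the support function only sees the convex hull of \<open>K\<close>, and the supremum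
  of the empty set is a junk value.\<close>

definition strictly_convex_C2_body :: "(real^2) set \<Rightarrow> bool" where
  "strictly_convex_C2_body K \<longleftrightarrow>
     compact K \<and> convex K \<and> K \<noteq> {} \<and>
     C2_fun (support_fun K) \<and>
     (\<forall>t. support_fun K t + deriv (deriv (support_fun K)) t > 0)"

definition constant_width :: "(real^2) set \<Rightarrow> bool" where
  "constant_width K \<longleftrightarrow> (\<exists>w. \<forall>t. support_fun K t + support_fun K (t + pi) = w)"

text \<open>The curve enveloped by the lines \<open>x cos t + y sin t = f t\<close>, that is, the curve with
  generalized support function \<open>f\<close>: the point below solves this equation together with its
  \<open>t\<close>-derivative \<open>- x sin t + y cos t = f' t\<close>.\<close>

definition enveloped_curve :: "(real \<Rightarrow> real) \<Rightarrow> real \<Rightarrow> real^2" where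
  "enveloped_curve f t = f t *\<^sub>R unit_normal t + deriv f t *\<^sub>R unit_tangent t"

text \<open>Area with multiplicities enclosed by the above curve, for \<open>2\<pi>\<close>-periodic \<open>f\<close>.\<close>

definition enveloped_area :: "(real \<Rightarrow> real) \<Rightarrow> real" where
  "enveloped_area f = (1/2) * integral {0..2*pi} (\<lambda>t. (f t)\<^sup>2 - (deriv f t)\<^sup>2)"

definition boundary_curve :: "(real^2) set \<Rightarrow> real \<Rightarrow> real^2" where
  "boundary_curve K = enveloped_curve (support_fun K)"

definition boundary_length :: "(real^2) set \<Rightarrow> real" where
  "boundary_length K =
     integral {0..2*pi} (\<lambda>t. norm (vector_derivative (boundary_curve K) (at t)))"

text \<open>The normal line of the boundary at parameter \<open>u\<close> is \<open>- x sin u + y cos u = p' u\<close>;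
  with \<open>t = u + \<pi>/2\<close> this reads \<open>x cos t + y sin t = p' (t - \<pi>/2)\<close>.  The evolute is the
  envelope of these lines.\<close>

definition evolute_support :: "(real^2) set \<Rightarrow> real \<Rightarrow> real" where
  "evolute_support K t = deriv (support_fun K) (t - pi/2)"

definition evolute_area :: "(real^2) set \<Rightarrow> real" where
  "evolute_area K = enveloped_area (evolute_support K)"

definition steiner_point :: "(real^2) set \<Rightarrow> real^2" where
  "steiner_point K = (1/pi) *\<^sub>R integral {0..2*pi} (\<lambda>t. support_fun K t *\<^sub>R unit_normal t)"

definition steiner_support :: "(real^2) set \<Rightarrow> real \<Rightarrow> real" where
  "steiner_support K t =
     support_fun K t - steiner_point K $ 1 * cos t - steiner_point K $ 2 * sin t"

text \<open>The pedal curve with respect to the Steiner point is \<open>r = steiner_support K t\<close> in polar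
  coordinates centred at that point; its area is given by the polar area formula.\<close>

definition steiner_pedal_area :: "(real^2) set \<Rightarrow> real" where
  "steiner_pedal_area K = (1/2) * integral {0..2*pi} (\<lambda>t. (steiner_support K t)\<^sup>2)"

definition is_disk :: "(real^2) set \<Rightarrow> bool" where
  "is_disk K \<longleftrightarrow> (\<exists>c r. r > 0 \<and> K = cball c r)"

text \<open>\<open>f\<close> is the generalized support function of a curve parallel, at distance \<open>c\<close>, to a Steiner
  curve (deltoid) \<open>a cos t + b sin t + B sin (3 (t - t\<^sub>0))\<close>.\<close>

definition parallel_to_steiner_support :: "(real \<Rightarrow> real) \<Rightarrow> bool" where
  "parallel_to_steiner_support f \<longleftrightarrow>
     (\<exists>c a b B t\<^sub>0. B > 0 \<and>
        (\<forall>t. f t = c + a * cos t + b * sin t + B * sin (3 * (t - t\<^sub>0))))"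

definition bounded_by_parallel_to_steiner_curve :: "(real^2) set \<Rightarrow> bool" where
  "bounded_by_parallel_to_steiner_curve K \<longleftrightarrow> parallel_to_steiner_support (support_fun K)"

end

theory Submission imports Defs begin

text \<open>Let \<open>q\<close> be the support function with its mean and first harmonics removed. With
  \<open>Q\<^sub>k\<close> the integral of the squared \<open>k\<close>-th derivative of \<open>q\<close> over a period, the difference of the two
  sides is \<open>\<pi>/2 (Q\<^sub>2 - 85/9 Q\<^sub>1 + 4 Q\<^sub>0)\<close>, and this bracket is the integral of \<open>(q'' + 9 q)\<^sup>2\<close> plus
  \<open>77/9 (Q\<^sub>1 - 9 Q\<^sub>0)\<close>. Constant width makes \<open>q\<close> antiperiodic with period \<open>\<pi>\<close>, hence orthogonal to
  the second harmonics, so \<open>Q\<^sub>1 \<ge> 9 Q\<^sub>0\<close>; equality forces \<open>q'' + 9 q = 0\<close>. The Wirtinger inequality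
  is obtained without Fourier series: adding a suitable first harmonic to \<open>q\<close> makes it vanish at
  equidistant points with spacing \<open>\<pi>/3\<close>, where the Dirichlet inequality on each interval applies. The Lebesgue measure of \<open>K\<close> is expressed
  through the support function by slicing \<open>K\<close> vertically between its two boundary arcs.\<close>

section \<open>Sharp Wirtinger inequalities\<close>

lemma integrable_on_Icc_if_continuous_on_UNIV:
  fixes f :: "real \<Rightarrow> real"
  assumes "continuous_on UNIV f"
  shows "f integrable_on {a..b}"
  by (meson assms continuous_on_subset integrable_continuous_real subset_UNIV)

lemma has_integral_if_has_real_derivative:
  fixes f :: "real \<Rightarrow> real"
  assumes "a \<le> b" and "\<And>x. a \<le> x \<Longrightarrow> x \<le> b \<Longrightarrow> (f has_real_derivative f' x) (at x)"
  shows "(f' has_integral (f b - f a)) {a..b}"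
  using assms
  by (intro fundamental_theorem_of_calculus)
    (auto simp: has_real_derivative_iff_has_vector_derivative[symmetric] intro: has_field_derivative_at_within)

lemma continuous_on_UNIV_if_has_real_derivative:
  assumes "\<And>t. (f has_real_derivative f' t) (at t)"
  shows "continuous_on UNIV f"
  using assms by (meson DERIV_isCont continuous_at_imp_continuous_on)

lemma integral_periodic_shift:
  fixes f :: "real \<Rightarrow> real"
  assumes cont: "continuous_on UNIV f" and per: "\<And>t. f (t + P) = f t"
    and a: "0 \<le> a" "a \<le> P"
  shows "integral {a..a + P} f = integral {0..P} f"
proof -
  have int: "f integrable_on {u..v}" for u v
    using cont by (rule integrable_on_Icc_if_continuous_on_UNIV)
  have "integral {P..a + P} f = integral {0..a} (f \<circ> (+) P)"
    using integral_shift_Icc_real[of 0 a f P] by simp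
  also have "f \<circ> (+) P = f"
    using per by (auto simp: fun_eq_iff add.commute)
  finally have "integral {P..a + P} f = integral {0..a} f" .
  moreover have "integral {a..P} f + integral {P..a + P} f = integral {a..a + P} f"
    using a by (intro Henstock_Kurzweil_Integration.integral_combine int) auto
  moreover have "integral {0..a} f + integral {a..P} f = integral {0..P} f"
    using a by (intro Henstock_Kurzweil_Integration.integral_combine int) auto
  ultimately show ?thesis by simp
qed

lemma integral_antiperiodic:
  fixes f :: "real \<Rightarrow> real"
  assumes cont: "continuous_on UNIV f" and anti: "\<And>t. f (t + P) = - f t" and "0 \<le> P"
  shows "integral {0..2 * P} f = 0"
proof -
  have int: "f integrable_on {u..v}" for u v
    using cont by (rule integrable_on_Icc_if_continuous_on_UNIV)
  have "integral {P..2 * P} f = integral {0..P} (f \<circ> (+) P)"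
    using integral_shift_Icc_real[of 0 P f P] by simp
  also have "f \<circ> (+) P = (\<lambda>t. - f t)"
    using anti by (auto simp: fun_eq_iff add.commute)
  finally have "integral {P..2 * P} f = - integral {0..P} f" by simp
  moreover have "integral {0..P} f + integral {P..2 * P} f = integral {0..2 * P} f"
    using \<open>0 \<le> P\<close> by (intro Henstock_Kurzweil_Integration.integral_combine int) auto
  ultimately show ?thesis by simp
qed

section \<open>Orthogonality to constants and first harmonics\<close>

text \<open>The constant function is included, so these are the functions whose Fourier series
  starts at order two. Using \<open>has_integral\<close> carries integrability along with the
  value.\<close>

definition orth_first_harmonics :: "(real \<Rightarrow> real) \<Rightarrow> bool" where
  "orth_first_harmonics f \<longleftrightarrow>
     (f has_integral 0) {0..2 * pi} \<and>
     ((\<lambda>t. f t * cos t) has_integral 0) {0..2 * pi} \<and>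
     ((\<lambda>t. f t * sin t) has_integral 0) {0..2 * pi}"

text \<open>Integration by parts moves the derivative onto the trigonometric factor, which stays a
  first harmonic. The boundary terms cancel because \<open>f\<close> agrees at the two ends.\<close>

lemma orth_first_harmonics_derivative:
  assumes der: "\<And>t. (f has_real_derivative f' t) (at t)" and per: "f (2 * pi) = f 0"
    and orth: "orth_first_harmonics f"
  shows "orth_first_harmonics f'"
proof -
  have c: "((\<lambda>t. f' t * cos t - f t * sin t) has_integral
      f (2 * pi) * cos (2 * pi) - f 0 * cos 0) {0..2 * pi}"
    by (rule has_integral_if_has_real_derivative) (auto intro!: derivative_eq_intros der)
  have s: "((\<lambda>t. f' t * sin t + f t * cos t) has_integral
      f (2 * pi) * sin (2 * pi) - f 0 * sin 0) {0..2 * pi}"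
    by (rule has_integral_if_has_real_derivative) (auto intro!: derivative_eq_intros der)
  have o: "(f' has_integral f (2 * pi) - f 0) {0..2 * pi}"
    by (rule has_integral_if_has_real_derivative) (auto intro: der)
  have "((\<lambda>t. f' t * cos t - f t * sin t + f t * sin t) has_integral 0 + 0) {0..2 * pi}"
    using c orth per unfolding orth_first_harmonics_def by (intro has_integral_add) auto
  moreover have "((\<lambda>t. f' t * sin t + f t * cos t - f t * cos t) has_integral 0 - 0) {0..2 * pi}"
    using s orth per unfolding orth_first_harmonics_def by (intro has_integral_diff) auto
  ultimately show ?thesis
    using o per by (simp add: orth_first_harmonics_def)
qed

lemma has_integral_trig_period:
  shows "((\<lambda>t. cos t) has_integral 0) {0..2 * pi}"
    and "((\<lambda>t. sin t) has_integral 0) {0..2 * pi}"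
    and "((\<lambda>t. (cos t)\<^sup>2) has_integral pi) {0..2 * pi}"
    and "((\<lambda>t. (sin t)\<^sup>2) has_integral pi) {0..2 * pi}"
    and "((\<lambda>t. sin t * cos t) has_integral 0) {0..2 * pi}"
proof -
  have "((\<lambda>t. cos t) has_integral sin (2 * pi) - sin 0) {0..2 * pi}"
    by (rule has_integral_if_has_real_derivative) (auto intro!: derivative_eq_intros)
  then show "((\<lambda>t. cos t) has_integral 0) {0..2 * pi}" by simp
  have "((\<lambda>t. sin t) has_integral (- cos (2 * pi)) - (- cos 0)) {0..2 * pi}"
    by (rule has_integral_if_has_real_derivative) (auto intro!: derivative_eq_intros)
  then show "((\<lambda>t. sin t) has_integral 0) {0..2 * pi}" by simp
  have "((\<lambda>t. sin t * cos t) has_integral (sin (2 * pi))\<^sup>2 / 2 - (sin 0)\<^sup>2 / 2) {0..2 * pi}"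
    by (rule has_integral_if_has_real_derivative) (auto intro!: derivative_eq_intros)
  then show "((\<lambda>t. sin t * cos t) has_integral 0) {0..2 * pi}" by simp
  have "((\<lambda>t. (cos t)\<^sup>2) has_integral
      (2 * pi + sin (2 * pi) * cos (2 * pi)) / 2 - (0 + sin 0 * cos 0) / 2) {0..2 * pi}"
  proof (rule has_integral_if_has_real_derivative)
    fix t :: real
    have "((\<lambda>t. (t + sin t * cos t) / 2) has_real_derivative (1 + (cos t * cos t - sin t * sin t)) / 2) (at t)"
      by (auto intro!: derivative_eq_intros)
    also have "(1 + (cos t * cos t - sin t * sin t)) / 2 = (cos t)\<^sup>2"
      using sin_cos_squared_add[of t] unfolding power2_eq_square by argo
    finally show "((\<lambda>t. (t + sin t * cos t) / 2) has_real_derivative (cos t)\<^sup>2) (at t)" .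
  qed simp
  then show "((\<lambda>t. (cos t)\<^sup>2) has_integral pi) {0..2 * pi}" by simp
  have "((\<lambda>t. (sin t)\<^sup>2) has_integral
      (2 * pi - sin (2 * pi) * cos (2 * pi)) / 2 - (0 - sin 0 * cos 0) / 2) {0..2 * pi}"
  proof (rule has_integral_if_has_real_derivative)
    fix t :: real
    have "((\<lambda>t. (t - sin t * cos t) / 2) has_real_derivative (1 - (cos t * cos t - sin t * sin t)) / 2) (at t)"
      by (auto intro!: derivative_eq_intros)
    also have "(1 - (cos t * cos t - sin t * sin t)) / 2 = (sin t)\<^sup>2"
      using sin_cos_squared_add[of t] unfolding power2_eq_square by argo
    finally show "((\<lambda>t. (t - sin t * cos t) / 2) has_real_derivative (sin t)\<^sup>2) (at t)" .
  qed simp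
  then show "((\<lambda>t. (sin t)\<^sup>2) has_integral pi) {0..2 * pi}" by simp
qed

text \<open>Pythagoras for the splitting into constant, first harmonics and remainder: all cross
  terms integrate to zero. This takes the place of Parseval's identity.\<close>

lemma integral_square_first_harmonics:
  assumes cont: "continuous_on UNIV f" and orth: "orth_first_harmonics f"
  shows "integral {0..2 * pi} (\<lambda>t. (c + a * cos t + b * sin t + f t)\<^sup>2) =
    2 * pi * c\<^sup>2 + pi * (a\<^sup>2 + b\<^sup>2) + integral {0..2 * pi} (\<lambda>t. (f t)\<^sup>2)" (is "_ = _ + ?I")
proof -
  have f2: "((\<lambda>t. (f t)\<^sup>2) has_integral ?I) {0..2 * pi}"
    by (intro integrable_integral integrable_on_Icc_if_continuous_on_UNIV continuous_intros cont)
  have one: "((\<lambda>t. 1) has_integral 2 * pi) {0..2 * pi}"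
    using has_integral_const_real[of "1::real" 0 "2 * pi"] by simp
  have "((\<lambda>t. c\<^sup>2 * 1 + a\<^sup>2 * (cos t)\<^sup>2 + b\<^sup>2 * (sin t)\<^sup>2 + (2 * a * b) * (sin t * cos t)
      + (2 * c * a) * cos t + (2 * c * b) * sin t
      + (2 * c) * f t + (2 * a) * (f t * cos t) + (2 * b) * (f t * sin t) + (f t)\<^sup>2) has_integral
      c\<^sup>2 * (2 * pi) + a\<^sup>2 * pi + b\<^sup>2 * pi + (2 * a * b) * 0 + (2 * c * a) * 0 + (2 * c * b) * 0
      + (2 * c) * 0 + (2 * a) * 0 + (2 * b) * 0 + ?I) {0..2 * pi}"
    using orth unfolding orth_first_harmonics_def
    by (intro has_integral_add has_integral_mult_right has_integral_trig_period one f2) auto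
  also have "(\<lambda>t. c\<^sup>2 * 1 + a\<^sup>2 * (cos t)\<^sup>2 + b\<^sup>2 * (sin t)\<^sup>2 + (2 * a * b) * (sin t * cos t)
      + (2 * c * a) * cos t + (2 * c * b) * sin t
      + (2 * c) * f t + (2 * a) * (f t * cos t) + (2 * b) * (f t * sin t) + (f t)\<^sup>2)
    = (\<lambda>t. (c + a * cos t + b * sin t + f t)\<^sup>2)"
    by (simp add: fun_eq_iff power2_eq_square algebra_simps)
  finally show ?thesis
    by (simp add: integral_unique algebra_simps)
qed

section \<open>Dirichlet inequality on an interval and its consequences for antiperiodic
  functions\<close>

lemma dirichlet_poincare_less:
  fixes g :: "real \<Rightarrow> real"
  assumes "a < b" and der: "\<And>t. (g has_real_derivative g' t) (at t)" and cont: "continuous_on UNIV g'"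
    and g: "g a = 0" "g b = 0" and l: "0 < l" "l < pi / (b - a)"
  shows "l\<^sup>2 * integral {a..b} (\<lambda>t. (g t)\<^sup>2) \<le> integral {a..b} (\<lambda>t. (g' t)\<^sup>2)"
proof -
  have contg: "continuous_on UNIV g"
    using der by (rule continuous_on_UNIV_if_has_real_derivative)
  \<comment> \<open>\<open>w\<close> solves the Riccati equation \<open>w' + w\<^sup>2 = - l\<^sup>2\<close>, so \<open>(g' - w g)\<^sup>2\<close> differs from \<open>g'\<^sup>2 - l\<^sup>2 g\<^sup>2\<close>
    by the derivative of \<open>w g\<^sup>2\<close>; taking \<open>l\<close> strictly below \<open>\<pi> / (b - a)\<close> keeps \<open>w\<close> regular on \<open>[a, b]\<close>\<close>
  define w where "w t = - l * tan (l * (t - (a + b) / 2))" for t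
  have cos_pos: "cos (l * (t - (a + b) / 2)) > 0" if "a \<le> t" "t \<le> b" for t
  proof (rule cos_gt_zero_pi)
    have "l * (b - a) < pi" using l \<open>a < b\<close> by (simp add: field_simps)
    moreover have "l * (t - (a + b) / 2) \<le> l * ((b - a) / 2)"
      using that l by (intro mult_left_mono) (auto simp: field_simps)
    moreover have "l * (t - (a + b) / 2) \<ge> l * (- ((b - a) / 2))"
      using that l by (intro mult_left_mono) (auto simp: field_simps)
    ultimately show "- (pi / 2) < l * (t - (a + b) / 2)" "l * (t - (a + b) / 2) < pi / 2"
      by linarith+
  qed
  have derw: "(w has_real_derivative - l\<^sup>2 - (w t)\<^sup>2) (at t)" if "a \<le> t" "t \<le> b" for t
    unfolding w_def
    using cos_pos[OF that]
    by (auto intro!: derivative_eq_intros simp: power2_eq_square tan_def field_simps)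
  have "((\<lambda>t. (- l\<^sup>2 - (w t)\<^sup>2) * (g t)\<^sup>2 + 2 * w t * g t * g' t) has_integral
      w b * (g b)\<^sup>2 - w a * (g a)\<^sup>2) {a..b}"
    using \<open>a < b\<close>
    by (intro has_integral_if_has_real_derivative) (auto intro!: derivative_eq_intros der derw)
  then have 0: "((\<lambda>t. (- l\<^sup>2 - (w t)\<^sup>2) * (g t)\<^sup>2 + 2 * w t * g t * g' t) has_integral 0) {a..b}"
    using g by simp
  let ?I = "integral {a..b} (\<lambda>t. (g' t)\<^sup>2) - l\<^sup>2 * integral {a..b} (\<lambda>t. (g t)\<^sup>2)"
  have "((\<lambda>t. (g' t)\<^sup>2 - l\<^sup>2 * (g t)\<^sup>2) has_integral ?I) {a..b}"
    by (intro has_integral_diff has_integral_mult_right integrable_integral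
        integrable_on_Icc_if_continuous_on_UNIV continuous_intros cont contg)
  from has_integral_diff[OF this 0]
  have "((\<lambda>t. (g' t - w t * g t)\<^sup>2) has_integral ?I) {a..b}"
    by (simp add: power2_eq_square algebra_simps)
  then have "0 \<le> ?I" by (rule has_integral_nonneg) simp
  then show ?thesis by simp
qed

text \<open>The sharp constant is reached by letting \<open>l\<close> tend to
  \<open>pi / (b - a)\<close> from below, since \<open>dirichlet_poincare_less\<close> covers only
  the strict range.\<close>

lemma dirichlet_poincare:
  fixes g :: "real \<Rightarrow> real"
  assumes "a < b" and "\<And>t. (g has_real_derivative g' t) (at t)" and "continuous_on UNIV g'"
    and "g a = 0" "g b = 0"
  shows "(pi / (b - a))\<^sup>2 * integral {a..b} (\<lambda>t. (g t)\<^sup>2) \<le> integral {a..b} (\<lambda>t. (g' t)\<^sup>2)"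
proof (rule tendsto_upperbound)
  let ?c = "pi / (b - a)"
  show "((\<lambda>l. l\<^sup>2 * integral {a..b} (\<lambda>t. (g t)\<^sup>2)) \<longlongrightarrow> ?c\<^sup>2 * integral {a..b} (\<lambda>t. (g t)\<^sup>2)) (at_left ?c)"
    by (intro tendsto_intros)
  have "eventually (\<lambda>l. l \<in> {0<..<?c}) (at_left ?c)"
    using \<open>a < b\<close> by (intro eventually_at_leftI[of 0]) auto
  then show "\<forall>\<^sub>F l in at_left ?c. l\<^sup>2 * integral {a..b} (\<lambda>t. (g t)\<^sup>2) \<le> integral {a..b} (\<lambda>t. (g' t)\<^sup>2)"
    by eventually_elim (use dirichlet_poincare_less[OF assms] in auto)
qed simp

text \<open>The Dirichlet constant depends only on the spacing \<open>d\<close>, so the inequalities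
  on consecutive intervals add up.\<close>

lemma wirtinger_equidistant_zeros:
  fixes g :: "real \<Rightarrow> real"
  assumes "d > 0" and der: "\<And>t. (g has_real_derivative g' t) (at t)" and cont: "continuous_on UNIV g'"
    and zeros: "\<And>k. k \<le> n \<Longrightarrow> g (s + real k * d) = 0"
  shows "(pi / d)\<^sup>2 * integral {s..s + real n * d} (\<lambda>t. (g t)\<^sup>2) \<le> integral {s..s + real n * d} (\<lambda>t. (g' t)\<^sup>2)"
  using zeros
proof (induction n)
  case (Suc n)
  have contg: "continuous_on UNIV g"
    using der by (rule continuous_on_UNIV_if_has_real_derivative)
  define u v where "u = s + real n * d" and "v = s + real (Suc n) * d"
  have uv: "s \<le> u" "u < v" "v - u = d" and gu: "g u = 0" "g v = 0"
    using \<open>d > 0\<close> Suc.prems[of n] Suc.prems[of "Suc n"] by (auto simp: u_def v_def algebra_simps)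
  have "integral {s..u} (\<lambda>t. (g t)\<^sup>2) + integral {u..v} (\<lambda>t. (g t)\<^sup>2) = integral {s..v} (\<lambda>t. (g t)\<^sup>2)"
    using uv by (intro Henstock_Kurzweil_Integration.integral_combine integrable_on_Icc_if_continuous_on_UNIV continuous_intros contg) auto
  moreover have "integral {s..u} (\<lambda>t. (g' t)\<^sup>2) + integral {u..v} (\<lambda>t. (g' t)\<^sup>2) = integral {s..v} (\<lambda>t. (g' t)\<^sup>2)"
    using uv by (intro Henstock_Kurzweil_Integration.integral_combine integrable_on_Icc_if_continuous_on_UNIV continuous_intros cont) auto
  moreover have "(pi / d)\<^sup>2 * integral {s..u} (\<lambda>t. (g t)\<^sup>2) \<le> integral {s..u} (\<lambda>t. (g' t)\<^sup>2)"
    using Suc unfolding u_def by auto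
  moreover have "(pi / d)\<^sup>2 * integral {u..v} (\<lambda>t. (g t)\<^sup>2) \<le> integral {u..v} (\<lambda>t. (g' t)\<^sup>2)"
    using dirichlet_poincare[OF \<open>u < v\<close> der cont gu] uv by simp
  ultimately show ?case
    unfolding v_def[symmetric] by (smt (verit) distrib_left)
qed simp

lemma wirtinger_antiperiodic:
  fixes q :: "real \<Rightarrow> real"
  assumes der: "\<And>t. (q has_real_derivative q' t) (at t)" and cont: "continuous_on UNIV q'"
    and anti: "\<And>t. q (t + pi) = - q t" and orth: "orth_first_harmonics q"
  shows "9 * integral {0..2 * pi} (\<lambda>t. (q t)\<^sup>2) \<le> integral {0..2 * pi} (\<lambda>t. (q' t)\<^sup>2)"
proof -
  have contq: "continuous_on UNIV q"
    using der by (rule continuous_on_UNIV_if_has_real_derivative)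
  have q2pi: "q (2 * pi) = q 0" using anti[of pi] anti[of 0] by simp
  \<comment> \<open>\<open>h\<close> annihilates the first harmonics, so at a zero \<open>t0\<close> of \<open>h\<close> the two coefficients that make
    \<open>g\<close> vanish at \<open>t0\<close> and \<open>t0 + \<pi>/3\<close> also make it vanish at \<open>t0 + 2\<pi>/3\<close>\<close>
  define h where "h t = q t - q (t + pi / 3) + q (t + 2 * pi / 3)" for t
  have "continuous_on {0..pi / 3} h"
    unfolding h_def by (intro continuous_intros continuous_on_compose2[OF contq]) auto
  \<comment> \<open>Since \<open>q (t + pi) = - q t\<close>, the alternating sum changes sign under
    a shift by pi/3, which forces a zero of \<open>h\<close> in between.\<close>
  moreover have "h (pi / 3) = - h 0"
    using anti[of 0] unfolding h_def by simp
  ultimately obtain t0 where t0: "0 \<le> t0" "t0 \<le> pi / 3" "h t0 = 0"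
    using IVT'[of h 0 0 "pi / 3"] IVT2'[of h "pi / 3" 0 0] by fastforce
  \<comment> \<open>The value of \<open>c\<close> is dictated by \<open>g (t0 + pi / 3) = 0\<close>,
    with cos(pi/3) = 1/2 and sin(pi/3) = sqrt 3 / 2. The coefficients \<open>a\<close> and
    \<open>b\<close> re-express the harmonic centred at \<open>t0\<close> in terms of cos t and sin
    t.\<close>
  define c where "c = (q (t0 + pi / 3) - q t0 / 2) / (sqrt 3 / 2)"
  define a b where "a = - q t0 * cos t0 + c * sin t0" and "b = - q t0 * sin t0 - c * cos t0"
  define g g' where "g t = 0 + a * cos t + b * sin t + q t" and "g' t = 0 + b * cos t + (- a) * sin t + q' t" for t
  have g_eq: "g t = q t - q t0 * cos (t - t0) - c * sin (t - t0)" for t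
    unfolding g_def a_def b_def by (simp add: cos_diff sin_diff algebra_simps)
  have derg: "(g has_real_derivative g' t) (at t)" for t
    unfolding g_def g'_def by (auto intro!: derivative_eq_intros der)
  have contg: "continuous_on UNIV g" and contg': "continuous_on UNIV g'"
    unfolding g_def g'_def by (intro continuous_intros contq cont)+
  have antig: "g (t + pi) = - g t" for t
    unfolding g_def using anti by simp
  have perg: "g (t + 2 * pi) = g t" for t
    using antig[of t] antig[of "t + pi"] by (simp add: algebra_simps)
  have perg': "g' (t + 2 * pi) = g' t" for t
  proof (rule DERIV_unique)
    show "((\<lambda>t. g (t + 2 * pi)) has_real_derivative g' (t + 2 * pi)) (at t)"
      using derg[of "t + 2 * pi"] by (simp add: DERIV_shift)
    show "((\<lambda>t. g (t + 2 * pi)) has_real_derivative g' t) (at t)"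
      using derg[of t] by (simp add: perg)
  qed
  have "cos (2 * pi / 3) = - 1 / 2" "sin (2 * pi / 3) = sqrt 3 / 2"
    using cos_120 sin_120 by simp_all
  then have "g (t0 + 2 * pi / 3) = q (t0 + 2 * pi / 3) - q t0 * (- 1 / 2) - c * (sqrt 3 / 2)"
    unfolding g_eq by simp
  moreover have "c * (sqrt 3 / 2) = q (t0 + pi / 3) - q t0 / 2" unfolding c_def by simp
  ultimately have "g (t0 + 2 * pi / 3) = h t0" unfolding h_def by linarith
  then have z2: "g (t0 + 2 * pi / 3) = 0" using t0 by simp
  have z0: "g t0 = 0" unfolding g_eq by simp
  have z1: "g (t0 + pi / 3) = 0" unfolding g_eq c_def by (simp add: cos_60 sin_60)
  \<comment> \<open>Seven consecutive zeros bound six intervals, exactly one period: antiperiodicity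
    yields k = 3, 4, 5 from the first three, and periodicity yields k = 6.\<close>
  have zeros: "g (t0 + real k * (pi / 3)) = 0" if "k \<le> 6" for k
  proof -
    consider "k = 0" | "k = 1" | "k = 2" | "k = 3" | "k = 4" | "k = 5" | "k = 6"
      using \<open>k \<le> 6\<close> by linarith
    then show ?thesis
      using z0 z1 z2 antig[of t0] antig[of "t0 + pi / 3"] antig[of "t0 + 2 * pi / 3"] perg[of t0]
      by cases (simp_all add: algebra_simps add_divide_distrib[symmetric])
  qed
  have "(pi / (pi / 3))\<^sup>2 * integral {t0..t0 + real 6 * (pi / 3)} (\<lambda>t. (g t)\<^sup>2)
      \<le> integral {t0..t0 + real 6 * (pi / 3)} (\<lambda>t. (g' t)\<^sup>2)"
    by (rule wirtinger_equidistant_zeros[OF _ derg contg' zeros]) auto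
  then have "9 * integral {t0..t0 + 2 * pi} (\<lambda>t. (g t)\<^sup>2) \<le> integral {t0..t0 + 2 * pi} (\<lambda>t. (g' t)\<^sup>2)"
    by (simp add: power2_eq_square)
  moreover have "integral {t0..t0 + 2 * pi} (\<lambda>t. (g t)\<^sup>2) = integral {0..2 * pi} (\<lambda>t. (g t)\<^sup>2)"
    using t0 by (intro integral_periodic_shift continuous_intros contg) (auto simp: perg)
  moreover have "integral {t0..t0 + 2 * pi} (\<lambda>t. (g' t)\<^sup>2) = integral {0..2 * pi} (\<lambda>t. (g' t)\<^sup>2)"
    using t0 by (intro integral_periodic_shift continuous_intros contg') (auto simp: perg')
  moreover have "integral {0..2 * pi} (\<lambda>t. (g t)\<^sup>2) =
      2 * pi * 0\<^sup>2 + pi * (a\<^sup>2 + b\<^sup>2) + integral {0..2 * pi} (\<lambda>t. (q t)\<^sup>2)"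
    unfolding g_def by (rule integral_square_first_harmonics[OF contq orth])
  moreover have "integral {0..2 * pi} (\<lambda>t. (g' t)\<^sup>2) =
      2 * pi * 0\<^sup>2 + pi * (b\<^sup>2 + (- a)\<^sup>2) + integral {0..2 * pi} (\<lambda>t. (q' t)\<^sup>2)"
    unfolding g'_def
    by (rule integral_square_first_harmonics[OF cont orth_first_harmonics_derivative[OF der q2pi orth]])
  \<comment> \<open>The added first harmonic contributes \<open>pi * (a\<^sup>2 + b\<^sup>2)\<close>
    nine times on the left and once on the right, so it only strengthens the inequality for
    \<open>q\<close>.\<close>
  ultimately have "8 * (pi * (a\<^sup>2 + b\<^sup>2)) + 9 * integral {0..2 * pi} (\<lambda>t. (q t)\<^sup>2)
      \<le> integral {0..2 * pi} (\<lambda>t. (q' t)\<^sup>2)"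
    by (simp add: add.commute)
  moreover have "0 \<le> 8 * (pi * (a\<^sup>2 + b\<^sup>2))" by simp
  ultimately show ?thesis by linarith
qed

section \<open>Support functions of constant width\<close>

text \<open>Rotating the phase vector (q, q'/3) by the angle 3t gives \<open>u\<close> and
  \<open>v\<close>, which are first integrals of the equation; undoing the rotation recovers
  \<open>q\<close>.\<close>

lemma third_harmonic_ode:
  fixes q :: "real \<Rightarrow> real"
  assumes der: "\<And>t. (q has_real_derivative q' t) (at t)" "\<And>t. (q' has_real_derivative q'' t) (at t)"
    and ode: "\<And>t. q'' t + 9 * q t = 0"
  obtains a b where "\<And>t. q t = a * cos (3 * t) + b * sin (3 * t)"
proof -
  have ode': "q'' t = - 9 * q t" for t using ode[of t] by simp
  define u v where "u t = q t * cos (3 * t) - q' t * sin (3 * t) / 3"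
    and "v t = q t * sin (3 * t) + q' t * cos (3 * t) / 3" for t
  have "(u has_real_derivative 0) (at t)" for t
    unfolding u_def by (auto intro!: derivative_eq_intros der simp: ode')
  moreover have "(v has_real_derivative 0) (at t)" for t
    unfolding v_def by (auto intro!: derivative_eq_intros der simp: ode' field_simps)
  ultimately have "u t = u 0" "v t = v 0" for t
    by (auto intro: DERIV_isconst_all)
  moreover have "q t = u t * cos (3 * t) + v t * sin (3 * t)" for t
  proof -
    have "u t * cos (3 * t) + v t * sin (3 * t) = q t * ((cos (3 * t))\<^sup>2 + (sin (3 * t))\<^sup>2)"
    proof -
      have "(x * C - y * S / 3) * C + (x * S + y * C / 3) * S = x * (C\<^sup>2 + S\<^sup>2)" for x y C S :: real
        by (simp add: power2_eq_square algebra_simps)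
      then show ?thesis unfolding u_def v_def .
    qed
    then show ?thesis by simp
  qed
  ultimately show ?thesis using that by metis
qed

text \<open>Eigenfunctions of the second derivative with different eigenvalues are orthogonal.
  Concretely, \<open>r' t * cos t + r t * sin t\<close> has derivative
  \<open>- 8 * (r t * cos t)\<close>, where 8 = 9 - 1, and its boundary values agree; likewise with
  sine.\<close>

lemma orth_first_harmonics_third_harmonic:
  fixes r :: "real \<Rightarrow> real"
  assumes der: "\<And>t. (r has_real_derivative r' t) (at t)" "\<And>t. (r' has_real_derivative - 9 * r t) (at t)"
    and per: "r (2 * pi) = r 0" "r' (2 * pi) = r' 0"
  shows "orth_first_harmonics r"
proof -
  have "((\<lambda>t. - 9 * r t) has_integral r' (2 * pi) - r' 0) {0..2 * pi}"
    by (rule has_integral_if_has_real_derivative[OF _ der(2)]) simp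
  from has_integral_mult_right[OF this, of "- 1 / 9"]
  have 1: "(r has_integral 0) {0..2 * pi}" using per by simp
  have "((\<lambda>t. - 8 * (r t * cos t)) has_integral
      (r' (2 * pi) * cos (2 * pi) + r (2 * pi) * sin (2 * pi)) - (r' 0 * cos 0 + r 0 * sin 0)) {0..2 * pi}"
    by (rule has_integral_if_has_real_derivative)
      (auto intro!: derivative_eq_intros der simp: algebra_simps)
  from has_integral_mult_right[OF this, of "- 1 / 8"]
  have 2: "((\<lambda>t. r t * cos t) has_integral 0) {0..2 * pi}" using per by simp
  have "((\<lambda>t. - 8 * (r t * sin t)) has_integral
      (r' (2 * pi) * sin (2 * pi) - r (2 * pi) * cos (2 * pi)) - (r' 0 * sin 0 - r 0 * cos 0)) {0..2 * pi}"
    by (rule has_integral_if_has_real_derivative)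
      (auto intro!: derivative_eq_intros der simp: algebra_simps)
  from has_integral_mult_right[OF this, of "- 1 / 8"]
  have 3: "((\<lambda>t. r t * sin t) has_integral 0) {0..2 * pi}" using per by simp
  from 1 2 3 show ?thesis by (simp add: orth_first_harmonics_def)
qed

section \<open>Fourier splitting of a support function of constant width\<close>

text \<open>This isolates the analytic content of constant width from convex geometry. Applying
  \<open>width\<close> twice gives periodicity with period 2 pi.\<close>

locale constant_width_support =
  fixes p p' p'' :: "real \<Rightarrow> real" and w :: real
  assumes der: "\<And>t. (p has_real_derivative p' t) (at t)"
    and der': "\<And>t. (p' has_real_derivative p'' t) (at t)"
    and cont'': "continuous_on UNIV p''"
    and width: "\<And>t. p t + p (t + pi) = w"
begin

text \<open>\<open>s1\<close> and \<open>s2\<close> are at once the first Fourier coefficients of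
  \<open>p\<close> and the coordinates of the Steiner point. As \<open>w / 2\<close> is the mean of
  \<open>p\<close>, the function \<open>q\<close> below is the part of order at least two, and
  constant width leaves only its odd harmonics.\<close>

definition "s1 = (1 / pi) * integral {0..2 * pi} (\<lambda>t. p t * cos t)"
definition "s2 = (1 / pi) * integral {0..2 * pi} (\<lambda>t. p t * sin t)"
definition "q t = p t - w / 2 - s1 * cos t - s2 * sin t"
definition "q' t = p' t + s1 * sin t - s2 * cos t"
definition "q'' t = p'' t + s1 * cos t + s2 * sin t"

lemma cont: "continuous_on UNIV p" and cont': "continuous_on UNIV p'"
  using continuous_on_UNIV_if_has_real_derivative[OF der]
    continuous_on_UNIV_if_has_real_derivative[OF der'] .

lemma der_q: "(q has_real_derivative q' t) (at t)" and der_q': "(q' has_real_derivative q'' t) (at t)"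
  unfolding q_def q'_def q''_def by (auto intro!: derivative_eq_intros der der')

lemma cont_q: "continuous_on UNIV q" and cont_q': "continuous_on UNIV q'"
  and cont_q'': "continuous_on UNIV q''"
  unfolding q_def q'_def q''_def by (intro continuous_intros cont cont' cont'')+

lemma antiperiodic_q: "q (t + pi) = - q t"
  using width[of t] by (simp add: q_def)

lemma periodic_q: "q (t + 2 * pi) = q t"
  using antiperiodic_q[of t] antiperiodic_q[of "t + pi"] by (simp add: algebra_simps)

lemma periodic_q': "q' (t + 2 * pi) = q' t"
proof (rule DERIV_unique)
  show "((\<lambda>t. q (t + 2 * pi)) has_real_derivative q' (t + 2 * pi)) (at t)"
    using der_q[of "t + 2 * pi"] by (simp add: DERIV_shift)
  show "((\<lambda>t. q (t + 2 * pi)) has_real_derivative q' t) (at t)"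
    using der_q[of t] by (simp add: periodic_q)
qed

lemma periodic_q'': "q'' (t + 2 * pi) = q'' t"
proof (rule DERIV_unique)
  show "((\<lambda>t. q' (t + 2 * pi)) has_real_derivative q'' (t + 2 * pi)) (at t)"
    using der_q'[of "t + 2 * pi"] by (simp add: DERIV_shift)
  show "((\<lambda>t. q' (t + 2 * pi)) has_real_derivative q'' t) (at t)"
    using der_q'[of t] by (simp add: periodic_q')
qed

text \<open>The leading zeros and negated coefficients match the pattern of
  \<open>integral_square_first_harmonics\<close>.\<close>

lemma p_eq: "p t = w / 2 + s1 * cos t + s2 * sin t + q t"
  and p'_eq: "p' t = 0 + s2 * cos t + (- s1) * sin t + q' t"
  and p''_eq: "p'' t = 0 + (- s1) * cos t + (- s2) * sin t + q'' t"
  by (simp_all add: q_def q'_def q''_def)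

lemma has_integral_p_trig:
  "((\<lambda>t. p t * cos t) has_integral pi * s1) {0..2 * pi}"
  "((\<lambda>t. p t * sin t) has_integral pi * s2) {0..2 * pi}"
  unfolding s1_def s2_def
  by (auto intro!: integrable_integral integrable_on_Icc_if_continuous_on_UNIV continuous_intros cont)

lemma orth_q: "orth_first_harmonics q"
proof -
  have "integral {0..2 * pi} q = 0"
    using cont_q antiperiodic_q by (rule integral_antiperiodic) simp
  then have 1: "(q has_integral 0) {0..2 * pi}"
    using integrable_integral[OF integrable_on_Icc_if_continuous_on_UNIV[OF cont_q], of 0 "2 * pi"] by simp
  have "((\<lambda>t. p t * cos t - (w / 2) * cos t - s1 * (cos t)\<^sup>2 - s2 * (sin t * cos t))
      has_integral pi * s1 - (w / 2) * 0 - s1 * pi - s2 * 0) {0..2 * pi}"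
    by (intro has_integral_diff has_integral_mult_right has_integral_trig_period has_integral_p_trig)
  then have 2: "((\<lambda>t. q t * cos t) has_integral 0) {0..2 * pi}"
    by (simp add: q_def power2_eq_square algebra_simps)
  have "((\<lambda>t. p t * sin t - (w / 2) * sin t - s1 * (sin t * cos t) - s2 * (sin t)\<^sup>2)
      has_integral pi * s2 - (w / 2) * 0 - s1 * 0 - s2 * pi) {0..2 * pi}"
    by (intro has_integral_diff has_integral_mult_right has_integral_trig_period has_integral_p_trig)
  then have 3: "((\<lambda>t. q t * sin t) has_integral 0) {0..2 * pi}"
    by (simp add: q_def power2_eq_square algebra_simps)
  from 1 2 3 show ?thesis by (simp add: orth_first_harmonics_def)
qed

lemma orth_q': "orth_first_harmonics q'"
  using der_q periodic_q[of 0] orth_q by (intro orth_first_harmonics_derivative[of q q']) auto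

lemma orth_q'': "orth_first_harmonics q''"
  using der_q' periodic_q'[of 0] orth_q' by (intro orth_first_harmonics_derivative[of q' q'']) auto

section \<open>Quadratic integrals of the support function and its derivatives\<close>

definition "P0 = integral {0..2 * pi} (\<lambda>t. (p t)\<^sup>2)"
definition "P1 = integral {0..2 * pi} (\<lambda>t. (p' t)\<^sup>2)"
definition "P2 = integral {0..2 * pi} (\<lambda>t. (p'' t)\<^sup>2)"
definition "Q0 = integral {0..2 * pi} (\<lambda>t. (q t)\<^sup>2)"
definition "Q1 = integral {0..2 * pi} (\<lambda>t. (q' t)\<^sup>2)"
definition "Q2 = integral {0..2 * pi} (\<lambda>t. (q'' t)\<^sup>2)"

lemma P_eq:
  "P0 = 2 * pi * (w / 2)\<^sup>2 + pi * (s1\<^sup>2 + s2\<^sup>2) + Q0"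
  "P1 = pi * (s1\<^sup>2 + s2\<^sup>2) + Q1"
  "P2 = pi * (s1\<^sup>2 + s2\<^sup>2) + Q2"
proof -
  show "P0 = 2 * pi * (w / 2)\<^sup>2 + pi * (s1\<^sup>2 + s2\<^sup>2) + Q0"
    using integral_square_first_harmonics[OF cont_q orth_q, of "w / 2" s1 s2]
    unfolding P0_def Q0_def p_eq[symmetric] .
  have "P1 = 2 * pi * 0\<^sup>2 + pi * (s2\<^sup>2 + (- s1)\<^sup>2) + Q1"
    using integral_square_first_harmonics[OF cont_q' orth_q', of 0 s2 "- s1"]
    unfolding P1_def Q1_def p'_eq[symmetric] .
  then show "P1 = pi * (s1\<^sup>2 + s2\<^sup>2) + Q1" by simp
  have "P2 = 2 * pi * 0\<^sup>2 + pi * ((- s1)\<^sup>2 + (- s2)\<^sup>2) + Q2"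
    using integral_square_first_harmonics[OF cont_q'' orth_q'', of 0 "- s1" "- s2"]
    unfolding P2_def Q2_def p''_eq[symmetric] .
  then show "P2 = pi * (s1\<^sup>2 + s2\<^sup>2) + Q2" by simp
qed

lemma integral_p: "integral {0..2 * pi} p = pi * w"
proof -
  have "((\<lambda>t. (w / 2) * 1 + s1 * cos t + s2 * sin t + q t) has_integral
      (w / 2) * (2 * pi) + s1 * 0 + s2 * 0 + 0) {0..2 * pi}"
    using orth_q has_integral_const_real[of "1::real" 0 "2 * pi"] unfolding orth_first_harmonics_def
    by (intro has_integral_add has_integral_mult_right has_integral_trig_period) auto
  then have "((\<lambda>t. w / 2 + s1 * cos t + s2 * sin t + q t) has_integral pi * w) {0..2 * pi}"
    by (simp add: mult.commute)
  then show ?thesis unfolding p_eq[symmetric] by (rule integral_unique)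
qed

text \<open>Taking the Steiner point as origin deletes exactly the first harmonics, leaving the mean
  and \<open>q\<close>.\<close>

lemma integral_pedal:
  "integral {0..2 * pi} (\<lambda>t. (p t - s1 * cos t - s2 * sin t)\<^sup>2) = 2 * pi * (w / 2)\<^sup>2 + Q0"
proof -
  have "integral {0..2 * pi} (\<lambda>t. (w / 2 + 0 * cos t + 0 * sin t + q t)\<^sup>2) =
      2 * pi * (w / 2)\<^sup>2 + pi * (0\<^sup>2 + 0\<^sup>2) + Q0"
    unfolding Q0_def by (rule integral_square_first_harmonics[OF cont_q orth_q])
  moreover have "w / 2 + 0 * cos t + 0 * sin t + q t = p t - s1 * cos t - s2 * sin t" for t
    by (simp add: q_def)
  ultimately show ?thesis by simp
qed

lemma has_integral_q_q'': "((\<lambda>t. q t * q'' t) has_integral - Q1) {0..2 * pi}"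
proof -
  have "((\<lambda>t. q t * q'' t + (q' t)\<^sup>2) has_integral q (2 * pi) * q' (2 * pi) - q 0 * q' 0) {0..2 * pi}"
    by (rule has_integral_if_has_real_derivative)
      (auto intro!: derivative_eq_intros der_q der_q' simp: power2_eq_square)
  moreover have "((\<lambda>t. (q' t)\<^sup>2) has_integral Q1) {0..2 * pi}"
    unfolding Q1_def
    by (intro integrable_integral integrable_on_Icc_if_continuous_on_UNIV continuous_intros cont_q')
  ultimately have "((\<lambda>t. q t * q'' t + (q' t)\<^sup>2 - (q' t)\<^sup>2) has_integral
      q (2 * pi) * q' (2 * pi) - q 0 * q' 0 - Q1) {0..2 * pi}"
    by (rule has_integral_diff)
  then show ?thesis using periodic_q[of 0] periodic_q'[of 0] by simp
qed

lemma integral_ode_square: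
  "integral {0..2 * pi} (\<lambda>t. (q'' t + 9 * q t)\<^sup>2) = Q2 - 18 * Q1 + 81 * Q0"
proof -
  have "((\<lambda>t. (q'' t)\<^sup>2 + 18 * (q t * q'' t) + 81 * (q t)\<^sup>2) has_integral
      Q2 + 18 * (- Q1) + 81 * Q0) {0..2 * pi}"
    unfolding Q2_def Q0_def
    by (intro has_integral_add has_integral_mult_right has_integral_q_q'' integrable_integral
        integrable_on_Icc_if_continuous_on_UNIV continuous_intros cont_q cont_q'')
  moreover have "(\<lambda>t. (q'' t)\<^sup>2 + 18 * (q t * q'' t) + 81 * (q t)\<^sup>2) = (\<lambda>t. (q'' t + 9 * q t)\<^sup>2)"
    by (simp add: fun_eq_iff power2_eq_square algebra_simps)
  ultimately show ?thesis by (simp add: integral_unique)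
qed

lemma Q_nonneg: "0 \<le> Q0" "0 \<le> Q1"
  unfolding Q0_def Q1_def
  by (auto intro!: integral_nonneg integrable_on_Icc_if_continuous_on_UNIV continuous_intros cont_q cont_q')

lemma wirtinger_q: "9 * Q0 \<le> Q1"
  unfolding Q0_def Q1_def using der_q cont_q' antiperiodic_q orth_q by (rule wirtinger_antiperiodic)

lemma ode_square_nonneg: "0 \<le> integral {0..2 * pi} (\<lambda>t. (q'' t + 9 * q t)\<^sup>2)"
  by (auto intro!: integral_nonneg integrable_on_Icc_if_continuous_on_UNIV continuous_intros cont_q cont_q'')

text \<open>This fixes the sign of the evolute area, so that the absolute value can be resolved.
  Nonnegativity of the square gives Q2 \<ge> 18 Q1 - 81 Q0, and the Wirtinger inequality bounds this
  below by 9 Q1.\<close>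

lemma P1_le_P2: "P1 \<le> P2"
  using wirtinger_q Q_nonneg ode_square_nonneg unfolding integral_ode_square P_eq by linarith

section \<open>The deficit form and its equality case\<close>

text \<open>On the harmonic of order k this form has the multiplier k^4 - 85/9 k^2 + 4 = (k^2 -
  9)(k^2 - 4/9), which vanishes at k = 3 and is positive beyond. The next lemma is the rewriting
  (k^2 - 9)^2 + 77/9 (k^2 - 9).\<close>

definition "deficit = Q2 - 85 / 9 * Q1 + 4 * Q0"

lemma deficit_eq:
  "deficit = integral {0..2 * pi} (\<lambda>t. (q'' t + 9 * q t)\<^sup>2) + 77 / 9 * (Q1 - 9 * Q0)"
  unfolding integral_ode_square deficit_def by (simp add: field_simps)

lemma deficit_nonneg: "0 \<le> deficit"
  using wirtinger_q ode_square_nonneg unfolding deficit_eq by simp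

text \<open>Both summands in \<open>deficit_eq\<close> are nonnegative, so the integral of the
  square is zero. Continuity gives the equation on one period, and periodicity gives it
  everywhere.\<close>

lemma ode_if_deficit_eq_0:
  assumes "deficit = 0"
  shows "q'' t + 9 * q t = 0"
proof -
  have "integral {0..2 * pi} (\<lambda>t. (q'' t + 9 * q t)\<^sup>2) = 0"
    using assms wirtinger_q ode_square_nonneg unfolding deficit_eq by (simp add: add_nonneg_eq_0_iff)
  then have on_period: "q'' t + 9 * q t = 0" if "t \<in> {0..2 * pi}" for t
  proof (subst (asm) integral_eq_0_iff)
    show "continuous_on {0..2 * pi} (\<lambda>t. (q'' t + 9 * q t)\<^sup>2)"
      by (rule continuous_on_subset[of UNIV]) (auto intro!: continuous_intros cont_q cont_q'')
  qed (use that in auto)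
  define k where "k t = q'' t + 9 * q t" for t
  have shift: "k (t + 2 * pi) = k t" for t
    unfolding k_def by (simp add: periodic_q periodic_q'')
  interpret periodic_fun_simple k "2 * pi" by standard (rule shift)
  define n where "n = \<lfloor>t / (2 * pi)\<rfloor>"
  have "of_int n \<le> t / (2 * pi)" "t / (2 * pi) < of_int n + 1"
    unfolding n_def by linarith+
  then have "t - of_int n * (2 * pi) \<in> {0..2 * pi}"
    by (simp add: field_simps)
  then have "k (t - of_int n * (2 * pi)) = 0" unfolding k_def by (rule on_period)
  then show ?thesis using minus_of_int[of t n] unfolding k_def by simp
qed

text \<open>Multiplying the equation by \<open>q\<close> and integrating by parts gives Q1 = 9 Q0,
  so the second summand of \<open>deficit_eq\<close> vanishes along with the first.\<close>

lemma deficit_eq_0_if_ode: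
  assumes "\<And>t. q'' t + 9 * q t = 0"
  shows "deficit = 0"
proof -
  have "q'' t = - 9 * q t" for t using assms[of t] by simp
  then have "((\<lambda>t. - 9 * (q t)\<^sup>2) has_integral - Q1) {0..2 * pi}"
    using has_integral_q_q'' by (simp add: power2_eq_square mult.left_commute)
  moreover have "((\<lambda>t. - 9 * (q t)\<^sup>2) has_integral - 9 * Q0) {0..2 * pi}"
    unfolding Q0_def by (intro has_integral_mult_right integrable_integral
        integrable_on_Icc_if_continuous_on_UNIV continuous_intros cont_q)
  ultimately have "- Q1 = - 9 * Q0" by (rule has_integral_unique)
  then show ?thesis unfolding deficit_eq using assms by simp
qed

text \<open>Allowing \<open>B = 0\<close> treats disks and parallels of deltoids together; they are
  separated in the final theorem.\<close>

lemma deficit_eq_0_iff: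
  "deficit = 0 \<longleftrightarrow>
    (\<exists>c a b B t0. 0 \<le> B \<and> (\<forall>t. p t = c + a * cos t + b * sin t + B * sin (3 * (t - t0))))"
proof
  assume "deficit = 0"
  then obtain A B where AB: "\<And>t. q t = A * cos (3 * t) + B * sin (3 * t)"
    using third_harmonic_ode[OF der_q der_q' ode_if_deficit_eq_0] by metis
  define R where "R = sqrt (A\<^sup>2 + B\<^sup>2)"
  \<comment> \<open>Amplitude and phase form: R sin(3t - u) expands to the given combination. Any
    \<open>u\<close> serves when \<open>R = 0\<close>.\<close>
  obtain u where u: "A = - R * sin u" "B = R * cos u"
  proof (cases "R = 0")
    case True
    then have "A = 0" "B = 0" unfolding R_def by (simp_all add: sum_power2_eq_zero_iff)
    then show ?thesis using True that by auto
  next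
    case False
    have "(B / R)\<^sup>2 + (- A / R)\<^sup>2 = 1"
      using False unfolding R_def by (simp add: power_divide add_divide_distrib[symmetric] add.commute)
    then obtain u where "B / R = cos u" "- A / R = sin u" by (rule sincos_total_2pi)
    then have "A = - R * sin u" "B = R * cos u" using False by (auto simp: field_simps)
    then show ?thesis using that by blast
  qed
  have "q t = R * sin (3 * (t - u / 3))" for t
    unfolding AB u by (simp add: sin_diff right_diff_distrib)
  then have "\<forall>t. p t = w / 2 + s1 * cos t + s2 * sin t + R * sin (3 * (t - u / 3))"
    by (simp add: p_eq)
  moreover have "0 \<le> R" unfolding R_def by simp
  ultimately show "\<exists>c a b B t0. 0 \<le> B \<and> (\<forall>t. p t = c + a * cos t + b * sin t + B * sin (3 * (t - t0)))"
    by blast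
next
  assume "\<exists>c a b B t0. 0 \<le> B \<and> (\<forall>t. p t = c + a * cos t + b * sin t + B * sin (3 * (t - t0)))"
  then obtain c a b B t0 where p: "\<And>t. p t = c + a * cos t + b * sin t + B * sin (3 * (t - t0))"
    by blast
  \<comment> \<open>The goal is \<open>q = r\<close>. As \<open>r\<close> is antiperiodic and
    orthogonal to the first harmonics, comparing integrals identifies \<open>c\<close>,
    \<open>a\<close>, \<open>b\<close> with \<open>w / 2\<close>, \<open>s1\<close>,
    \<open>s2\<close>.\<close>
  define r r' where "r t = B * sin (3 * (t - t0))" and "r' t = B * cos (3 * (t - t0)) * 3" for t
  have der_r: "(r has_real_derivative r' t) (at t)" "(r' has_real_derivative - 9 * r t) (at t)" for t
    unfolding r_def r'_def by (auto intro!: derivative_eq_intros)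
  have rpi: "r (t + pi) = - r t" for t
  proof -
    have "r (t + pi) = B * sin (3 * (t - t0) + pi + 2 * pi)"
      unfolding r_def by (simp add: algebra_simps)
    also have "\<dots> = - r t" unfolding r_def sin_periodic by simp
    finally show ?thesis .
  qed
  have per: "r (2 * pi) = r 0" using rpi[of 0] rpi[of pi] by simp
  have "r' (2 * pi) = B * cos (3 * (0 - t0) + 2 * pi + 2 * pi + 2 * pi) * 3"
    unfolding r'_def by (simp add: algebra_simps)
  also have "\<dots> = r' 0" unfolding r'_def cos_periodic by simp
  finally have orth_r: "orth_first_harmonics r"
    using der_r per by (intro orth_first_harmonics_third_harmonic[of r r']) auto
  have "w = 2 * c" using width[of 0] rpi[of 0] unfolding p r_def[symmetric] by simp
  have "((\<lambda>t. c * cos t + a * (cos t)\<^sup>2 + b * (sin t * cos t) + r t * cos t)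
      has_integral c * 0 + a * pi + b * 0 + 0) {0..2 * pi}"
    using orth_r unfolding orth_first_harmonics_def
    by (intro has_integral_add has_integral_mult_right has_integral_trig_period) auto
  also have "(\<lambda>t. c * cos t + a * (cos t)\<^sup>2 + b * (sin t * cos t) + r t * cos t) = (\<lambda>t. p t * cos t)"
    by (simp add: fun_eq_iff p r_def power2_eq_square algebra_simps)
  finally have "s1 = a"
    using has_integral_unique[OF has_integral_p_trig(1)] by fastforce
  have "((\<lambda>t. c * sin t + a * (sin t * cos t) + b * (sin t)\<^sup>2 + r t * sin t)
      has_integral c * 0 + a * 0 + b * pi + 0) {0..2 * pi}"
    using orth_r unfolding orth_first_harmonics_def
    by (intro has_integral_add has_integral_mult_right has_integral_trig_period) auto
  also have "(\<lambda>t. c * sin t + a * (sin t * cos t) + b * (sin t)\<^sup>2 + r t * sin t) = (\<lambda>t. p t * sin t)"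
    by (simp add: fun_eq_iff p r_def power2_eq_square algebra_simps)
  finally have "s2 = b"
    using has_integral_unique[OF has_integral_p_trig(2)] by fastforce
  have "w / 2 = c" using \<open>w = 2 * c\<close> by simp
  have "q t = r t" for t
  proof -
    have "q t = p t - c - a * cos t - b * sin t"
      unfolding q_def \<open>w / 2 = c\<close> \<open>s1 = a\<close> \<open>s2 = b\<close> ..
    also have "\<dots> = r t" using p[of t] unfolding r_def by linarith
    finally show ?thesis .
  qed
  then have "q = r" by blast
  then have "q' = r'"
    using DERIV_unique[OF der_q] der_r(1) by blast
  then have "q'' t = - 9 * q t" for t
    using DERIV_unique[OF der_q'] der_r(2) \<open>q = r\<close> by blast
  then show "deficit = 0" by (intro deficit_eq_0_if_ode) simp
qed

text \<open>The three terms are the two sides of the inequality after inserting F = (P0 - P1)/2 and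
  L = pi w. The contributions of the mean and of \<open>s1\<close>, \<open>s2\<close> cancel,
  leaving only the Q terms.\<close>

lemma isoperimetric_deficit_identity:
  "pi / 2 * (P2 - P1) - ((pi * w)\<^sup>2 - 2 * pi * (P0 - P1))
    - 20 / 9 * pi * (2 * pi * (w / 2)\<^sup>2 + Q0 - (P0 - P1)) = pi / 2 * deficit"
  unfolding P_eq deficit_def by (simp add: power2_eq_square field_simps)

end

section \<open>Area and length of a convex body in terms of its support function\<close>

lemma inner_unit_normal: "x \<bullet> unit_normal t = x $ 1 * cos t + x $ 2 * sin t"
  by (simp add: unit_normal_def inner_vec_def sum_2)

text \<open>Written as a linear combination of fixed vectors, a pair becomes accessible to the rules
  for continuity, measurability and derivatives.\<close>

lemma vector_2_eq_axis: "vector [x, y] = x *\<^sub>R axis 1 1 + y *\<^sub>R (axis 2 1 :: real^2)"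
  by (simp add: vec_eq_iff forall_2 axis_def)

lemma vector_2_components: "vector [v $ 1, v $ 2] = (v :: real^2)"
  by (simp add: vec_eq_iff forall_2)

lemma support_fun_ge:
  assumes "compact K" "x \<in> K"
  shows "x \<bullet> unit_normal t \<le> support_fun K t"
proof -
  have "compact ((\<lambda>x. x \<bullet> unit_normal t) ` K)"
    by (intro compact_continuous_image continuous_intros assms)
  then show ?thesis unfolding support_fun_def
    using assms(2) by (intro cSup_upper) (auto dest: compact_imp_bounded bounded_imp_bdd_above)
qed

lemma support_fun_attained:
  assumes "compact K" "K \<noteq> {}"
  obtains x where "x \<in> K" "x \<bullet> unit_normal t = support_fun K t"
proof -
  obtain x where x: "x \<in> K" "\<And>y. y \<in> K \<Longrightarrow> y \<bullet> unit_normal t \<le> x \<bullet> unit_normal t"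
  proof -
    have "continuous_on K (\<lambda>x. x \<bullet> unit_normal t)" by (intro continuous_intros)
    with that show thesis using continuous_attains_sup[OF assms] by blast
  qed
  then have "support_fun K t = x \<bullet> unit_normal t"
    unfolding support_fun_def by (intro cSup_eq_maximum) auto
  with x that show ?thesis by simp
qed

lemma support_fun_periodic: "support_fun K (t + 2 * pi) = support_fun K t"
  by (simp add: support_fun_def inner_unit_normal)

lemma support_fun_cball:
  assumes "0 \<le> r"
  shows "support_fun (cball c r) t = r + c $ 1 * cos t + c $ 2 * sin t"
proof -
  have N: "unit_normal t \<bullet> unit_normal t = 1"
    by (simp add: inner_unit_normal) (simp add: unit_normal_def)
  have normN: "norm (unit_normal t) = 1" by (simp add: norm_eq_sqrt_inner N)
  have "support_fun (cball c r) t = (c + r *\<^sub>R unit_normal t) \<bullet> unit_normal t"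
    unfolding support_fun_def
  proof (rule cSup_eq_maximum)
    show "(c + r *\<^sub>R unit_normal t) \<bullet> unit_normal t \<in> (\<lambda>x. x \<bullet> unit_normal t) ` cball c r"
      using \<open>0 \<le> r\<close> by (intro imageI) (simp add: dist_norm normN)
    fix y assume "y \<in> (\<lambda>x. x \<bullet> unit_normal t) ` cball c r"
    then obtain x where "x \<in> cball c r" and y: "y = x \<bullet> unit_normal t" by blast
    then have x: "norm (x - c) \<le> r" by (simp add: dist_norm norm_minus_commute)
    have "(x - c) \<bullet> unit_normal t \<le> norm (x - c) * norm (unit_normal t)"
      by (rule norm_cauchy_schwarz)
    then show "y \<le> (c + r *\<^sub>R unit_normal t) \<bullet> unit_normal t"
      using x y by (simp add: normN inner_add_left inner_diff_left N)
  qed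
  then show ?thesis by (simp add: inner_add_left N) (simp add: inner_unit_normal)
qed

lemma polar_decomposition:
  fixes v :: "real^2"
  obtains t where "v = norm v *\<^sub>R unit_normal t"
proof (cases "v = 0")
  case False
  have n: "norm v = sqrt ((v $ 1)\<^sup>2 + (v $ 2)\<^sup>2)"
    by (simp add: norm_eq_sqrt_inner inner_vec_def sum_2 power2_eq_square)
  have "(v $ 1 / norm v)\<^sup>2 + (v $ 2 / norm v)\<^sup>2 = 1"
    using False by (simp add: power_divide add_divide_distrib[symmetric] n vec_eq_iff forall_2)
  then obtain t where t: "v $ 1 / norm v = cos t" "v $ 2 / norm v = sin t"
    by (rule sincos_total_2pi)
  have "v = norm v *\<^sub>R unit_normal t"
    using False by (simp add: vec_eq_iff forall_2 unit_normal_def t[symmetric])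
  then show ?thesis by (rule that)
qed (auto intro: that)

section \<open>Planar Lebesgue measure by vertical slices\<close>

text \<open>Lebesgue measure is determined by its values on boxes, and the preimage of a box under
  the coordinate map is the box with the same sides.\<close>

lemma lborel_vec_2: "(lborel :: (real^2) measure) = distr lborel borel (\<lambda>(x, y). vector [x, y])"
proof (rule lborel_eqI)
  let ?f = "\<lambda>(x, y). vector [x, y] :: real^2"
  have [measurable]: "?f \<in> borel \<rightarrow>\<^sub>M borel"
    unfolding vector_2_eq_axis case_prod_unfold
    by (intro borel_measurable_continuous_onI continuous_intros)
  fix l u :: "real^2"
  assume le: "\<And>b. b \<in> Basis \<Longrightarrow> l \<bullet> b \<le> u \<bullet> b"
  have lu: "l $ i \<le> u $ i" for i
    using le[of "axis i 1"] by (simp add: inner_axis axis_in_Basis_iff)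
  have Basis: "(Basis :: (real^2) set) = {axis 1 1, axis 2 1}"
    unfolding Basis_vec_def by (auto simp: UNIV_2)
  have ne: "axis 1 1 \<noteq> (axis 2 1 :: real^2)" by (simp add: axis_eq_axis)
  have "?f -` box l u = box (l $ 1, l $ 2) (u $ 1, u $ 2)"
    by (auto simp: mem_box_cart forall_2 box_prod)
  then have "emeasure (distr lborel borel ?f) (box l u) = emeasure lborel (box (l $ 1, l $ 2) (u $ 1, u $ 2))"
    by (simp add: emeasure_distr)
  also have "\<dots> = ennreal ((u $ 1 - l $ 1) * (u $ 2 - l $ 2))"
    using lu by (subst emeasure_lborel_box) (auto simp: Basis_prod_def)
  also have "(u $ 1 - l $ 1) * (u $ 2 - l $ 2) = (\<Prod>b\<in>Basis. (u - l) \<bullet> b)"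
    unfolding Basis using ne by (simp add: inner_axis)
  finally show "emeasure (distr lborel borel ?f) (box l u) = ennreal (\<Prod>b\<in>Basis. (u - l) \<bullet> b)" .
qed simp

text \<open>Cavalieri's principle, obtained from Tonelli on pairs by transport along the coordinate
  map.\<close>

lemma emeasure_lborel_slices:
  fixes K :: "(real^2) set"
  assumes [measurable]: "K \<in> sets borel"
  shows "emeasure lborel K = (\<integral>\<^sup>+x. emeasure lborel {y. vector [x, y] \<in> K} \<partial>lborel)"
proof -
  let ?f = "\<lambda>(x, y). vector [x, y] :: real^2"
  have f: "?f \<in> borel \<rightarrow>\<^sub>M borel"
    unfolding vector_2_eq_axis case_prod_unfold
    by (intro borel_measurable_continuous_onI continuous_intros)
  then have f_lborel: "?f \<in> lborel \<rightarrow>\<^sub>M borel" by simp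
  have "emeasure lborel K = emeasure (lborel \<Otimes>\<^sub>M lborel) (?f -` K)"
    using f_lborel by (subst lborel_vec_2) (simp add: emeasure_distr lborel_prod)
  also have "\<dots> = (\<integral>\<^sup>+x. emeasure lborel (Pair x -` (?f -` K)) \<partial>lborel)"
  proof (rule lborel.emeasure_pair_measure_alt)
    show "?f -` K \<in> sets (lborel \<Otimes>\<^sub>M lborel)"
      unfolding lborel_prod using measurable_sets[OF f assms] by simp
  qed
  finally show ?thesis by (simp add: vimage_def)
qed

section \<open>Boundary points and vertical slices of a convex body\<close>

locale C2_convex_body =
  fixes K :: "(real^2) set" and p p' p'' :: "real \<Rightarrow> real"
  assumes compact: "compact K" and convex: "convex K" and nonempty: "K \<noteq> {}"
    and p_def: "p = support_fun K"
    and der: "\<And>t. (p has_real_derivative p' t) (at t)"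
    and der': "\<And>t. (p' has_real_derivative p'' t) (at t)"
    and cont'': "continuous_on UNIV p''"
    and curvature_radius_pos: "\<And>t. 0 < p t + p'' t"
begin

text \<open>\<open>X\<close> and \<open>Y\<close> are the coordinates of the boundary point with
  outer unit normal at angle \<open>t\<close>.\<close>

definition "X t = p t * cos t - p' t * sin t"
definition "Y t = p t * sin t + p' t * cos t"

lemma cont: "continuous_on UNIV p" and cont': "continuous_on UNIV p'"
  using continuous_on_UNIV_if_has_real_derivative[OF der]
    continuous_on_UNIV_if_has_real_derivative[OF der'] .

lemma der_X: "(X has_real_derivative - (p t + p'' t) * sin t) (at t)"
  and der_Y: "(Y has_real_derivative (p t + p'' t) * cos t) (at t)"
  unfolding X_def Y_def by (auto intro!: derivative_eq_intros der der' simp: algebra_simps)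

lemma cont_X: "continuous_on S X" and cont_Y: "continuous_on S Y"
  using continuous_on_UNIV_if_has_real_derivative[OF der_X]
    continuous_on_UNIV_if_has_real_derivative[OF der_Y]
  by (auto intro: continuous_on_subset)

lemma periodic: "p (t + 2 * pi) = p t"
  unfolding p_def by (rule support_fun_periodic)

lemma periodic': "p' (t + 2 * pi) = p' t"
proof (rule DERIV_unique)
  show "((\<lambda>t. p (t + 2 * pi)) has_real_derivative p' (t + 2 * pi)) (at t)"
    using der[of "t + 2 * pi"] by (simp add: DERIV_shift)
  show "((\<lambda>t. p (t + 2 * pi)) has_real_derivative p' t) (at t)"
    using der[of t] by (simp add: periodic)
qed

lemma X_2pi: "X (2 * pi) = X 0" and Y_2pi: "Y (2 * pi) = Y 0"
  using periodic[of 0] periodic'[of 0] by (simp_all add: X_def Y_def)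

lemma support_ge: "v \<in> K \<Longrightarrow> v $ 1 * cos t + v $ 2 * sin t \<le> p t"
  using support_fun_ge[OF compact] by (simp add: p_def inner_unit_normal)

text \<open>The gap between \<open>p s\<close> and the inner product of \<open>v\<close> with the
  normal at angle \<open>s\<close> is nonnegative and vanishes at \<open>s = t\<close>, so its
  derivative vanishes there. The two resulting linear equations determine \<open>v\<close>.\<close>

lemma contact_point_eq:
  assumes v: "v \<in> K" and contact: "v $ 1 * cos t + v $ 2 * sin t = p t"
  shows "v = vector [X t, Y t]"
proof -
  let ?f = "\<lambda>s. p s - (v $ 1 * cos s + v $ 2 * sin s)"
  have "(?f has_real_derivative p' t - (v $ 1 * (- sin t) + v $ 2 * cos t)) (at t)"
    by (auto intro!: derivative_eq_intros der)
  then have "p' t - (v $ 1 * (- sin t) + v $ 2 * cos t) = 0"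
    by (rule DERIV_local_min[of _ _ _ 1]) (use support_ge[OF v] contact in auto)
  then have p': "p' t = v $ 2 * cos t - v $ 1 * sin t" by simp
  have "X t = v $ 1 * ((sin t)\<^sup>2 + (cos t)\<^sup>2)" "Y t = v $ 2 * ((sin t)\<^sup>2 + (cos t)\<^sup>2)"
    unfolding X_def Y_def p' contact[symmetric] power2_eq_square by algebra+
  then have "X t = v $ 1" "Y t = v $ 2" by simp_all
  then show ?thesis by (simp add: vector_2_components)
qed

lemma contact_point_mem: "vector [X t, Y t] \<in> K"
proof -
  obtain v where "v \<in> K" "v \<bullet> unit_normal t = support_fun K t"
    using compact nonempty by (rule support_fun_attained)
  then show ?thesis using contact_point_eq[of v t] by (simp add: inner_unit_normal p_def)
qed

lemma X_Y_support: "X t * cos t + Y t * sin t = p t"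
proof -
  have "X t * cos t + Y t * sin t = p t * ((sin t)\<^sup>2 + (cos t)\<^sup>2)"
    unfolding X_def Y_def power2_eq_square by algebra
  then show ?thesis by simp
qed

text \<open>At abscissa \<open>X t\<close> the support inequality reduces to
  \<open>v $ 2 * sin t \<le> Y t * sin t\<close>. If \<open>sin t = 0\<close> the support line is
  vertical and uniqueness of the contact point forces equality.\<close>

lemma slice_bound:
  assumes v: "v \<in> K" and X: "v $ 1 = X t"
  shows "0 \<le> sin t \<Longrightarrow> v $ 2 \<le> Y t" and "sin t \<le> 0 \<Longrightarrow> Y t \<le> v $ 2"
proof -
  have le: "v $ 2 * sin t \<le> Y t * sin t"
    using support_ge[OF v, of t] X_Y_support[of t] unfolding X by simp
  have eq: "v $ 2 = Y t" if "sin t = 0"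
  proof -
    have "v = vector [X t, Y t]"
      using X_Y_support[of t] that X by (intro contact_point_eq v) simp
    then show ?thesis by simp
  qed
  show "v $ 2 \<le> Y t" if "0 \<le> sin t"
    using that le eq by (cases "sin t = 0") auto
  show "Y t \<le> v $ 2" if "sin t \<le> 0"
    using that le eq by (cases "sin t = 0") (auto simp: mult_le_cancel_right)
qed

text \<open>\<open>t\<close> parametrises the upper arc and \<open>u\<close> the lower one: the two
  boundary points bound the slice, and convexity fills the segment between them.\<close>

lemma slice_eq:
  assumes "X t = x" "0 \<le> sin t" "X u = x" "sin u \<le> 0"
  shows "{y. vector [x, y] \<in> K} = {Y u..Y t}" and "Y u \<le> Y t"
proof -
  have mem: "vector [x, Y t] \<in> K" "vector [x, Y u] \<in> K"
    using contact_point_mem[of t] contact_point_mem[of u] assms by auto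
  then show le: "Y u \<le> Y t"
    using slice_bound(1)[of "vector [x, Y u]" t] assms by simp
  show "{y. vector [x, y] \<in> K} = {Y u..Y t}"
  proof (intro equalityI subsetI)
    fix y assume "y \<in> {y. vector [x, y] \<in> K}"
    then show "y \<in> {Y u..Y t}"
      using slice_bound(1)[of "vector [x, y]" t] slice_bound(2)[of "vector [x, y]" u] assms by simp
  next
    fix y assume "y \<in> {Y u..Y t}"
    then have "y \<in> closed_segment (Y u) (Y t)"
      using le by (simp add: closed_segment_eq_real_ivl)
    then obtain m where m: "0 \<le> m" "m \<le> 1" "y = (1 - m) * Y u + m * Y t"
      by (auto simp: in_segment)
    then have "vector [x, y] = (1 - m) *\<^sub>R vector [x, Y u] + m *\<^sub>R (vector [x, Y t] :: real^2)"
      by (simp add: vec_eq_iff forall_2 algebra_simps)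
    then show "y \<in> {y. vector [x, y] \<in> K}"
      using convexD_alt[OF convex mem(2) mem(1), of m] m by simp
  qed
qed

section \<open>Area between the upper and lower boundary arcs\<close>

lemma X_strict_antimono_upper:
  assumes "0 \<le> s" "s < t" "t \<le> pi"
  shows "X t < X s"
proof (rule DERIV_neg_imp_decreasing_open[OF \<open>s < t\<close> _ cont_X])
  fix u assume "s < u" "u < t"
  then have "0 < sin u" using assms by (intro sin_gt_zero) auto
  then have "- (p u + p'' u) * sin u < 0"
    using curvature_radius_pos[of u] by (intro mult_neg_pos) linarith+
  then show "\<exists>y. (X has_real_derivative y) (at u) \<and> y < 0" using der_X by blast
qed

lemma X_strict_mono_lower:
  assumes "pi \<le> s" "s < t" "t \<le> 2 * pi"
  shows "X s < X t"
proof (rule DERIV_pos_imp_increasing_open[OF \<open>s < t\<close> _ cont_X])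
  fix u assume "s < u" "u < t"
  then have "sin u < 0" using assms by (intro sin_lt_zero) auto
  then have "0 < - (p u + p'' u) * sin u"
    using curvature_radius_pos[of u] by (intro mult_neg_neg) linarith+
  then show "\<exists>y. (X has_real_derivative y) (at u) \<and> 0 < y" using der_X by blast
qed

lemma inj_X: "inj_on X {0..pi}" "inj_on X {pi..2 * pi}"
proof -
  show "inj_on X {0..pi}"
  proof (rule inj_onI)
    fix s t assume "s \<in> {0..pi}" "t \<in> {0..pi}" "X s = X t"
    then show "s = t"
      using X_strict_antimono_upper[of s t] X_strict_antimono_upper[of t s]
      by (cases s t rule: linorder_cases) auto
  qed
  show "inj_on X {pi..2 * pi}"
  proof (rule inj_onI)
    fix s t assume "s \<in> {pi..2 * pi}" "t \<in> {pi..2 * pi}" "X s = X t"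
    then show "s = t"
      using X_strict_mono_lower[of s t] X_strict_mono_lower[of t s]
      by (cases s t rule: linorder_cases) auto
  qed
qed

lemma image_X: "X ` {0..pi} = {X pi..X 0}" "X ` {pi..2 * pi} = {X pi..X 0}"
proof -
  show "X ` {0..pi} = {X pi..X 0}"
  proof (intro equalityI subsetI)
    fix x assume "x \<in> X ` {0..pi}"
    then obtain s where s: "0 \<le> s" "s \<le> pi" "x = X s" by auto
    have "X pi \<le> X s" using s X_strict_antimono_upper[of s pi] by (cases "s = pi") auto
    moreover have "X s \<le> X 0" using s X_strict_antimono_upper[of 0 s] by (cases "s = 0") auto
    ultimately show "x \<in> {X pi..X 0}" using s by simp
  next
    fix x assume "x \<in> {X pi..X 0}"
    then have "\<exists>s\<ge>0. s \<le> pi \<and> X s = x" by (intro IVT2' cont_X) auto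
    then show "x \<in> X ` {0..pi}" by auto
  qed
  show "X ` {pi..2 * pi} = {X pi..X 0}"
  proof (intro equalityI subsetI)
    fix x assume "x \<in> X ` {pi..2 * pi}"
    then obtain s where s: "pi \<le> s" "s \<le> 2 * pi" "x = X s" by auto
    have "X pi \<le> X s" using s X_strict_mono_lower[of pi s] by (cases "s = pi") auto
    moreover have "X s \<le> X 0"
      using s X_strict_mono_lower[of s "2 * pi"] X_2pi by (cases "s = 2 * pi") auto
    ultimately show "x \<in> {X pi..X 0}" using s by simp
  next
    fix x assume "x \<in> {X pi..X 0}"
    then have "\<exists>s\<ge>pi. s \<le> 2 * pi \<and> X s = x" by (intro IVT' cont_X) (auto simp: X_2pi)
    then show "x \<in> X ` {pi..2 * pi}" by auto
  qed
qed

text \<open>Change of variables x = X t on an arc viewed as a graph. The absolute value of the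
  derivative of \<open>X\<close> serves the decreasing upper arc and the increasing lower arc
  alike.\<close>

lemma integral_graph:
  assumes inj: "inj_on X {a..b}"
  shows "((\<lambda>x. Y (inv_into {a..b} X x)) has_integral
    integral {a..b} (\<lambda>t. \<bar>(p t + p'' t) * sin t\<bar> * Y t)) (X ` {a..b})"
proof -
  let ?f = "\<lambda>x. Y (inv_into {a..b} X x)"
  let ?g = "\<lambda>t. \<bar>- (p t + p'' t) * sin t\<bar> * ?f (X t)"
  let ?h = "\<lambda>t. \<bar>(p t + p'' t) * sin t\<bar> * Y t"
  have eq: "?g t = ?h t" if "t \<in> {a..b}" for t
  proof -
    have "\<bar>- (p t + p'' t) * sin t\<bar> = \<bar>(p t + p'' t) * sin t\<bar>"
      unfolding mult_minus_left abs_minus_cancel ..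
    then show ?thesis unfolding inv_into_f_f[OF inj that] by (rule arg_cong[where f = "\<lambda>z. z * Y t"])
  qed
  have cont_h: "continuous_on {a..b} ?h"
    by (rule continuous_on_subset[OF _ subset_UNIV]) (intro continuous_intros cont cont'' cont_Y)
  have "continuous_on {a..b} ?g"
    using cont_h by (rule continuous_on_eq) (rule eq[symmetric])
  then have "?g absolutely_integrable_on {a..b}"
    by (rule absolutely_integrable_continuous_real)
  moreover have "integral {a..b} ?g = integral {a..b} ?h"
    by (rule integral_cong) (rule eq)
  ultimately have g: "?g absolutely_integrable_on {a..b} \<and> integral {a..b} ?g = integral {a..b} ?h" ..
  have "{a..b} \<in> sets lebesgue" by simp
  moreover have "(X has_real_derivative - (p t + p'' t) * sin t) (at t within {a..b})" for t
    using der_X by (rule has_field_derivative_at_within)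
  ultimately have "?f absolutely_integrable_on X ` {a..b} \<and> integral (X ` {a..b}) ?f = integral {a..b} ?h"
    by (rule has_absolute_integral_change_of_variables_1'[THEN iffD1, OF _ _ inj g])
  then show ?thesis
    using set_lebesgue_integral_eq_integral(1) has_integral_integrable_integral by blast
qed

text \<open>Integrating the slice lengths gives minus the line integral of Y dX around the boundary;
  this is then brought to its form in \<open>p\<close> by an exact differential.\<close>

lemma measure_eq: "measure lebesgue K = integral {0..2 * pi} (\<lambda>t. (p t)\<^sup>2 - (p' t)\<^sup>2) / 2"
proof -
  let ?t = "inv_into {0..pi} X" and ?u = "inv_into {pi..2 * pi} X"
  let ?h = "\<lambda>t. (p t + p'' t) * sin t * Y t"
  have R: "0 \<le> p t + p'' t" for t using curvature_radius_pos[of t] by simp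
  have h: "?h integrable_on {a..b}" for a b
    by (intro integrable_on_Icc_if_continuous_on_UNIV continuous_intros cont cont'' cont_Y)
  \<comment> \<open>The absolute value disappears on the upper half and yields a minus sign on the
    lower half, so upper minus lower becomes one integral over the whole period.\<close>
  have up: "integral {0..pi} (\<lambda>t. \<bar>(p t + p'' t) * sin t\<bar> * Y t) = integral {0..pi} ?h"
    by (rule integral_cong) (simp add: abs_mult sin_ge_zero R)
  have sin_le: "sin t \<le> 0" if "pi \<le> t" "t \<le> 2 * pi" for t
  proof (cases "t = 2 * pi")
    case False
    with that show ?thesis by (intro sin_le_zero) linarith+
  qed simp
  have "integral {pi..2 * pi} (\<lambda>t. \<bar>(p t + p'' t) * sin t\<bar> * Y t) = integral {pi..2 * pi} (\<lambda>t. - ?h t)"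
    by (rule integral_cong) (simp add: abs_mult sin_le R)
  then have low: "integral {pi..2 * pi} (\<lambda>t. \<bar>(p t + p'' t) * sin t\<bar> * Y t) = - integral {pi..2 * pi} ?h"
    by simp
  have "((\<lambda>x. Y (?t x) - Y (?u x)) has_integral
      integral {0..pi} ?h - (- integral {pi..2 * pi} ?h)) {X pi..X 0}"
    using integral_graph[OF inj_X(1)] integral_graph[OF inj_X(2)]
    unfolding image_X up low by (rule has_integral_diff)
  moreover have "integral {0..pi} ?h + integral {pi..2 * pi} ?h = integral {0..2 * pi} ?h"
    by (intro Henstock_Kurzweil_Integration.integral_combine h) auto
  ultimately have I: "((\<lambda>x. Y (?t x) - Y (?u x)) has_integral integral {0..2 * pi} ?h) {X pi..X 0}"
    by simp
  have slice: "{y. vector [x, y] \<in> K} = {Y (?u x)..Y (?t x)}" "Y (?u x) \<le> Y (?t x)"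
    if x: "x \<in> {X pi..X 0}" for x
  proof -
    have t: "?t x \<in> {0..pi}" "X (?t x) = x"
      using x image_X(1) by (metis inv_into_into, metis f_inv_into_f)
    have u: "?u x \<in> {pi..2 * pi}" "X (?u x) = x"
      using x image_X(2) by (metis inv_into_into, metis f_inv_into_f)
    have "0 \<le> sin (?t x)" "sin (?u x) \<le> 0"
      using t u by (auto intro: sin_ge_zero sin_le)
    with t u show "{y. vector [x, y] \<in> K} = {Y (?u x)..Y (?t x)}" "Y (?u x) \<le> Y (?t x)"
      by (auto dest: slice_eq(1) slice_eq(2))
  qed
  have empty: "{y. vector [x, y] \<in> K} = {}" if "x \<notin> {X pi..X 0}" for x
  proof (rule ccontr)
    assume "{y. vector [x, y] \<in> K} \<noteq> {}"
    then obtain y where y: "vector [x, y] \<in> K" by auto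
    have "x \<le> X 0" "X pi \<le> x"
      using support_ge[OF y, of 0] support_ge[OF y, of pi] by (auto simp: X_def)
    with that show False by simp
  qed
  have nonneg: "0 \<le> integral {0..2 * pi} ?h"
    using I by (rule has_integral_nonneg) (use slice(2) in auto)
  have "emeasure lborel K = (\<integral>\<^sup>+x. emeasure lborel {y. vector [x, y] \<in> K} \<partial>lborel)"
    using compact by (intro emeasure_lborel_slices borel_compact)
  also have "\<dots> = (\<integral>\<^sup>+x. ennreal (Y (?t x) - Y (?u x)) * indicator {X pi..X 0} x \<partial>lborel)"
    by (intro nn_integral_cong) (auto simp: slice empty split: split_indicator)
  also have "\<dots> = ennreal (integral {0..2 * pi} ?h)"
    using I by (intro nn_integral_has_integral_lebesgue') (use slice(2) in auto)
  finally have "emeasure lborel K = ennreal (integral {0..2 * pi} ?h)" .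
  then have m: "measure lebesgue K = integral {0..2 * pi} ?h"
    using nonneg borel_compact[OF compact] by (simp add: measure_def)
  \<comment> \<open>The term -XY/2 accounts for symmetrising -Y dX into (X dY - Y dX)/2, which is p
    (p + p'')/2 dt, and p p'/2 trades p p'' for -p'^2. \<open>?F\<close> has equal values at both
    ends, so it contributes nothing.\<close>
  let ?F = "\<lambda>t. (p t * p' t - X t * Y t) / 2"
  have "((\<lambda>t. ?h t - ((p t)\<^sup>2 - (p' t)\<^sup>2) / 2) has_integral ?F (2 * pi) - ?F 0) {0..2 * pi}"
  proof (rule has_integral_if_has_real_derivative)
    fix t
    have "((\<lambda>t. p t * p' t - X t * Y t) has_real_derivative
        p' t * p' t + p t * p'' t - (- (p t + p'' t) * sin t * Y t + X t * ((p t + p'' t) * cos t))) (at t)"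
      by (auto intro!: derivative_eq_intros der der' der_X der_Y simp: algebra_simps)
    then have "(?F has_real_derivative
        (p' t * p' t + p t * p'' t - (- (p t + p'' t) * sin t * Y t + X t * ((p t + p'' t) * cos t))) / 2) (at t)"
      by (rule DERIV_cdivide)
    moreover have "(p' t * p' t + p t * p'' t - (- (p t + p'' t) * sin t * Y t + X t * ((p t + p'' t) * cos t))) / 2
        = ?h t - ((p t)\<^sup>2 - (p' t)\<^sup>2) / 2"
    proof -
      have "X t * ((p t + p'' t) * cos t) = (p t + p'' t) * (p t - Y t * sin t)"
      proof -
        have "X t * ((p t + p'' t) * cos t) = (p t + p'' t) * (X t * cos t)" by (rule mult.left_commute)
        also have "X t * cos t = p t - Y t * sin t" using X_Y_support[of t] by linarith
        finally show ?thesis .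
      qed
      moreover have "(b * b + a * c - (- (a + c) * s * y + (a + c) * (a - y * s))) / 2
          = (a + c) * s * y - (a\<^sup>2 - b\<^sup>2) / 2" for a b c s y :: real
        by (simp add: power2_eq_square field_simps)
      ultimately show ?thesis by (simp only:)
    qed
    ultimately show "(?F has_real_derivative ?h t - ((p t)\<^sup>2 - (p' t)\<^sup>2) / 2) (at t)" by (rule DERIV_cong)
  qed simp
  then have "((\<lambda>t. ?h t - ((p t)\<^sup>2 - (p' t)\<^sup>2) / 2) has_integral 0) {0..2 * pi}"
    using X_2pi Y_2pi periodic[of 0] periodic'[of 0] by simp
  then have "integral {0..2 * pi} (\<lambda>t. ?h t - ((p t)\<^sup>2 - (p' t)\<^sup>2) / 2) = 0"
    by (rule integral_unique)
  moreover have "integral {0..2 * pi} (\<lambda>t. ?h t - ((p t)\<^sup>2 - (p' t)\<^sup>2) / 2)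
      = integral {0..2 * pi} ?h - integral {0..2 * pi} (\<lambda>t. ((p t)\<^sup>2 - (p' t)\<^sup>2) / 2)"
    by (intro Henstock_Kurzweil_Integration.integral_diff h integrable_on_Icc_if_continuous_on_UNIV
        continuous_intros cont cont') auto
  ultimately show ?thesis by (simp add: m)
qed

section \<open>Length, evolute area and Steiner point\<close>

lemma deriv_p: "deriv p = p'"
  using der by (auto intro!: DERIV_imp_deriv)

text \<open>Cauchy's formula: the speed in the normal angle is the radius of curvature
  \<open>p t + p'' t\<close>, and \<open>p''\<close> integrates to zero over a period.\<close>

lemma boundary_length_eq: "boundary_length K = integral {0..2 * pi} p"
proof -
  have eq: "boundary_curve K = (\<lambda>t. X t *\<^sub>R axis 1 1 + Y t *\<^sub>R axis 2 1)"
    unfolding boundary_curve_def enveloped_curve_def p_def[symmetric] deriv_p X_def Y_def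
      unit_normal_def unit_tangent_def vector_2_eq_axis
    by (simp add: fun_eq_iff algebra_simps)
  have "norm (vector_derivative (boundary_curve K) (at t)) = p t + p'' t" for t
  proof -
    have "(boundary_curve K has_vector_derivative
        (- (p t + p'' t) * sin t) *\<^sub>R axis 1 1 + ((p t + p'' t) * cos t) *\<^sub>R axis 2 1) (at t)"
      unfolding eq by (auto intro!: derivative_eq_intros der_X der_Y)
    then have "vector_derivative (boundary_curve K) (at t) =
        (p t + p'' t) *\<^sub>R (vector [- sin t, cos t] :: real^2)"
      by (simp add: vector_derivative_at vector_2_eq_axis algebra_simps)
    then have "norm (vector_derivative (boundary_curve K) (at t)) =
        \<bar>p t + p'' t\<bar> * norm (vector [- sin t, cos t] :: real^2)"
      by simp
    also have "norm (vector [- sin t, cos t] :: real^2) = 1"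
      by (simp add: norm_eq_sqrt_inner inner_vec_def sum_2 power2_eq_square[symmetric])
    finally show ?thesis using curvature_radius_pos[of t] by simp
  qed
  then have "boundary_length K = integral {0..2 * pi} (\<lambda>t. p t + p'' t)"
    unfolding boundary_length_def by simp
  also have "\<dots> = integral {0..2 * pi} p + integral {0..2 * pi} p''"
    by (intro Henstock_Kurzweil_Integration.integral_add integrable_on_Icc_if_continuous_on_UNIV cont cont'')
  also have "(p'' has_integral p' (2 * pi) - p' 0) {0..2 * pi}"
    by (rule has_integral_if_has_real_derivative) (auto intro: der')
  then have "integral {0..2 * pi} p'' = 0"
    using periodic'[of 0] by (simp add: integral_unique)
  finally show ?thesis by simp
qed

lemma evolute_area_eq: "evolute_area K = integral {0..2 * pi} (\<lambda>t. (p' t)\<^sup>2 - (p'' t)\<^sup>2) / 2"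
proof -
  let ?g = "\<lambda>t. (p' t)\<^sup>2 - (p'' t)\<^sup>2"
  have periodic'': "p'' (t + 2 * pi) = p'' t" for t
  proof (rule DERIV_unique)
    show "((\<lambda>t. p' (t + 2 * pi)) has_real_derivative p'' (t + 2 * pi)) (at t)"
      using der'[of "t + 2 * pi"] by (simp add: DERIV_shift)
    show "((\<lambda>t. p' (t + 2 * pi)) has_real_derivative p'' t) (at t)"
      using der'[of t] by (simp add: periodic')
  qed
  have f: "evolute_support K t = p' (t - pi / 2)" for t
    by (simp add: evolute_support_def p_def[symmetric] deriv_p)
  have "(evolute_support K has_real_derivative p'' (t - pi / 2)) (at t)" for t
    unfolding f[abs_def] using der'[of "t - pi / 2"] DERIV_shift[of p' "p'' (t - pi / 2)" t "- (pi / 2)"] by simp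
  then have f': "deriv (evolute_support K) t = p'' (t - pi / 2)" for t
    by (rule DERIV_imp_deriv)
  \<comment> \<open>Modulo the period, the shift by -pi/2 equals the shift by 3 pi/2, which lies in
    the range required by \<open>integral_periodic_shift\<close>.\<close>
  have "(\<lambda>t. (evolute_support K t)\<^sup>2 - (deriv (evolute_support K) t)\<^sup>2) = ?g \<circ> (+) (3 * pi / 2)"
    using periodic'[of "t - pi / 2" for t] periodic''[of "t - pi / 2" for t]
    by (simp add: fun_eq_iff f f' algebra_simps)
  then have "integral {0..2 * pi} (\<lambda>t. (evolute_support K t)\<^sup>2 - (deriv (evolute_support K) t)\<^sup>2) =
      integral {3 * pi / 2..3 * pi / 2 + 2 * pi} ?g"
    using integral_shift_Icc_real[of 0 "2 * pi" ?g "3 * pi / 2"] by (simp add: add.commute)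
  also have "\<dots> = integral {0..2 * pi} ?g"
    by (rule integral_periodic_shift) (auto intro!: continuous_intros cont' cont'' simp: periodic' periodic'')
  finally show ?thesis by (simp add: evolute_area_def enveloped_area_def)
qed

lemma steiner_point_components:
  "steiner_point K $ 1 = (1 / pi) * integral {0..2 * pi} (\<lambda>t. p t * cos t)"
  "steiner_point K $ 2 = (1 / pi) * integral {0..2 * pi} (\<lambda>t. p t * sin t)"
proof -
  have "continuous_on UNIV (\<lambda>t. p t *\<^sub>R unit_normal t)"
    unfolding unit_normal_def vector_2_eq_axis by (intro continuous_intros cont)
  then have int: "(\<lambda>t. p t *\<^sub>R unit_normal t) integrable_on {0..2 * pi}"
    by (meson continuous_on_subset integrable_continuous_real subset_UNIV)
  show "steiner_point K $ 1 = (1 / pi) * integral {0..2 * pi} (\<lambda>t. p t * cos t)"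
    "steiner_point K $ 2 = (1 / pi) * integral {0..2 * pi} (\<lambda>t. p t * sin t)"
    using integral_component_eq_cart[OF int, of 1] integral_component_eq_cart[OF int, of 2]
    by (simp_all add: steiner_point_def p_def[symmetric] unit_normal_def)
qed

section \<open>Characterisation of disks\<close>

text \<open>For the converse, the support inequality in the direction of a point puts
  \<open>K\<close> inside the ball. The contact points run through the whole circle, and convexity
  fills its diameters.\<close>

lemma is_disk_iff: "is_disk K \<longleftrightarrow> (\<exists>c a b. \<forall>t. p t = c + a * cos t + b * sin t)"
proof
  assume "is_disk K"
  then obtain c r where "r > 0" "K = cball c r" unfolding is_disk_def by blast
  then have "\<forall>t. p t = r + c $ 1 * cos t + c $ 2 * sin t"
    by (simp add: p_def support_fun_cball)
  then show "\<exists>c a b. \<forall>t. p t = c + a * cos t + b * sin t" by blast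
next
  assume "\<exists>c a b. \<forall>t. p t = c + a * cos t + b * sin t"
  then obtain c a b where p: "\<And>t. p t = c + a * cos t + b * sin t" by blast
  have "((\<lambda>t. c + a * cos t + b * sin t) has_real_derivative b * cos t - a * sin t) (at t)" for t
    by (auto intro!: derivative_eq_intros)
  then have p': "p' t = b * cos t - a * sin t" for t
    using DERIV_unique[OF der[of t]] by (simp add: p[abs_def])
  have "((\<lambda>t. b * cos t - a * sin t) has_real_derivative - b * sin t - a * cos t) (at t)" for t
    by (auto intro!: derivative_eq_intros)
  then have p'': "p'' t = - b * sin t - a * cos t" for t
    using DERIV_unique[OF der'[of t]] by (simp add: p'[abs_def])
  \<comment> \<open>The trigonometric terms cancel in \<open>p t + p'' t\<close>, so the radius of
    curvature is the constant \<open>c\<close>.\<close>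
  have "c > 0" using curvature_radius_pos[of 0] by (simp add: p p'')
  let ?m = "vector [a, b] :: real^2"
  have "X t = a * ((sin t)\<^sup>2 + (cos t)\<^sup>2) + c * cos t" "Y t = b * ((sin t)\<^sup>2 + (cos t)\<^sup>2) + c * sin t" for t
    unfolding X_def Y_def p p' power2_eq_square by algebra+
  then have XY: "vector [X t, Y t] = ?m + c *\<^sub>R unit_normal t" for t
    by (simp add: unit_normal_def vec_eq_iff forall_2)
  have "K = cball ?m c"
  proof (intro equalityI subsetI)
    fix x assume "x \<in> K"
    obtain t where t: "x - ?m = norm (x - ?m) *\<^sub>R unit_normal t" by (rule polar_decomposition)
    have N: "unit_normal t \<bullet> unit_normal t = 1"
      by (simp add: inner_unit_normal) (simp add: unit_normal_def)
    have "norm (x - ?m) = (x - ?m) \<bullet> unit_normal t"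
      by (subst (2) t) (simp add: N)
    also have "\<dots> \<le> c"
      using support_ge[OF \<open>x \<in> K\<close>, of t] by (simp add: inner_unit_normal p algebra_simps)
    finally show "x \<in> cball ?m c" by (simp add: dist_norm norm_minus_commute)
  next
    fix x assume "x \<in> cball ?m c"
    then have x: "norm (x - ?m) \<le> c" by (simp add: dist_norm norm_minus_commute)
    obtain t where t: "x - ?m = norm (x - ?m) *\<^sub>R unit_normal t" by (rule polar_decomposition)
    have neg: "unit_normal (t + pi) = - unit_normal t"
      by (simp add: unit_normal_def vec_eq_iff forall_2)
    have mem: "?m + c *\<^sub>R unit_normal t \<in> K" "?m + c *\<^sub>R unit_normal (t + pi) \<in> K"
      using contact_point_mem[of t] contact_point_mem[of "t + pi"] by (simp_all only: XY)
    \<comment> \<open>\<open>x\<close> lies on the diameter in direction \<open>t\<close>. Weights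
      \<open>1 - s\<close> and \<open>s\<close> on its ends give the signed distance
      \<open>(1 - 2 * s) * c\<close> from the centre, which has to be
      \<open>norm (x - ?m)\<close>.\<close>
    define s where "s = (1 - norm (x - ?m) / c) / 2"
    have s: "0 \<le> s" "s \<le> 1" "(1 - 2 * s) * c = norm (x - ?m)"
      using x \<open>c > 0\<close> by (simp_all add: s_def field_simps)
    have "(1 - s) *\<^sub>R (?m + c *\<^sub>R unit_normal t) + s *\<^sub>R (?m + c *\<^sub>R unit_normal (t + pi))
        = ?m + ((1 - 2 * s) * c) *\<^sub>R unit_normal t"
      unfolding neg by (simp add: vec_eq_iff algebra_simps)
    also have "\<dots> = x" unfolding s(3) t[symmetric] by simp
    finally show "x \<in> K" using convexD_alt[OF convex mem s(1,2)] by simp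
  qed
  then show "is_disk K" using \<open>c > 0\<close> unfolding is_disk_def by blast
qed

end

section \<open>The inequality\<close>

lemma C2_fun_derivatives:
  assumes "C2_fun f"
  shows "(f has_real_derivative deriv f t) (at t)"
    and "(deriv f has_real_derivative deriv (deriv f) t) (at t)"
    and "continuous_on UNIV (deriv (deriv f))"
proof -
  have D: "(g has_real_derivative deriv g t) (at t) \<and> continuous_on UNIV (deriv g)"
    if C1: "g C1_differentiable_on UNIV" for g :: "real \<Rightarrow> real" and t
  proof -
    obtain D where D: "\<And>t. (g has_vector_derivative D t) (at t)" "continuous_on UNIV D"
      using C1 unfolding C1_differentiable_on_def by auto
    then have "deriv g = D"
      by (auto simp: has_real_derivative_iff_has_vector_derivative[symmetric] intro!: DERIV_imp_deriv)
    with D show ?thesis by (simp add: has_real_derivative_iff_has_vector_derivative)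
  qed
  show "(f has_real_derivative deriv f t) (at t)"
    and "(deriv f has_real_derivative deriv (deriv f) t) (at t)"
    and "continuous_on UNIV (deriv (deriv f))"
    using assms D unfolding C2_fun_def by blast+
qed

theorem corollary5p4:
  fixes K :: "(real^2) set" and F L F\<^sub>e \<Delta> A :: real
  assumes "strictly_convex_C2_body K"
    and "constant_width K"
    and "F = measure lebesgue K"
    and "L = boundary_length K"
    and "F\<^sub>e = evolute_area K"
    and "\<Delta> = L\<^sup>2 - 4 * pi * F"
    and "A = steiner_pedal_area K"
  shows "pi * \<bar>F\<^sub>e\<bar> - \<Delta> \<ge> 40/9 * pi * (A - F) \<and>
    (pi * \<bar>F\<^sub>e\<bar> - \<Delta> = 40/9 * pi * (A - F) \<longleftrightarrow>
      is_disk K \<or> bounded_by_parallel_to_steiner_curve K)"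
proof -
  define p where "p = support_fun K"
  obtain w where w: "\<And>t. p t + p (t + pi) = w"
    using assms(2) unfolding constant_width_def p_def by blast
  have body: "compact K" "convex K" "K \<noteq> {}" "C2_fun p" "\<And>t. p t + deriv (deriv p) t > 0"
    using assms(1) unfolding strictly_convex_C2_body_def p_def by blast+
  interpret C2_convex_body K p "deriv p" "deriv (deriv p)"
    using body C2_fun_derivatives[OF body(4)] by unfold_locales (auto simp: p_def)
  interpret W: constant_width_support p "deriv p" "deriv (deriv p)" w
    using w der der' cont'' by unfold_locales
  have diff: "integral {0..2 * pi} (\<lambda>t. (f t)\<^sup>2 - (g t)\<^sup>2) =
      integral {0..2 * pi} (\<lambda>t. (f t)\<^sup>2) - integral {0..2 * pi} (\<lambda>t. (g t)\<^sup>2)"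
    if "continuous_on UNIV f" "continuous_on UNIV g" for f g :: "real \<Rightarrow> real"
    using that by (intro Henstock_Kurzweil_Integration.integral_diff
        integrable_on_Icc_if_continuous_on_UNIV continuous_intros)
  have F: "F = (W.P0 - W.P1) / 2"
    unfolding assms(3) measure_eq W.P0_def W.P1_def by (simp add: diff cont cont')
  have "F\<^sub>e = (W.P1 - W.P2) / 2"
    unfolding assms(5) evolute_area_eq W.P1_def W.P2_def by (simp add: diff cont' cont'')
  \<comment> \<open>The evolute area is nonpositive, so its absolute value is its negative.\<close>
  then have Fe: "\<bar>F\<^sub>e\<bar> = (W.P2 - W.P1) / 2"
    using W.P1_le_P2 by simp
  have L: "L = pi * w"
    unfolding assms(4) boundary_length_eq by (rule W.integral_p)
  have "steiner_support K t = p t - W.s1 * cos t - W.s2 * sin t" for t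
    unfolding steiner_support_def steiner_point_components W.s1_def W.s2_def p_def[symmetric] ..
  then have A: "A = (2 * pi * (w / 2)\<^sup>2 + W.Q0) / 2"
    using W.integral_pedal by (simp add: assms(7) steiner_pedal_area_def)
  have "pi * \<bar>F\<^sub>e\<bar> - \<Delta> - 40/9 * pi * (A - F) = pi / 2 * W.deficit"
    unfolding W.isoperimetric_deficit_identity[symmetric] assms(6) F Fe L A by (simp add: field_simps)
  moreover have "0 \<le> pi / 2 * W.deficit" "pi / 2 * W.deficit = 0 \<longleftrightarrow> W.deficit = 0"
    using W.deficit_nonneg by simp_all
  ultimately have key: "pi * \<bar>F\<^sub>e\<bar> - \<Delta> \<ge> 40/9 * pi * (A - F)"
    "pi * \<bar>F\<^sub>e\<bar> - \<Delta> = 40/9 * pi * (A - F) \<longleftrightarrow> W.deficit = 0"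
    by linarith+
  \<comment> \<open>The two equality cases separate here: \<open>B = 0\<close> gives the disks and
    \<open>B > 0\<close> the parallels of a deltoid.\<close>
  have "(\<exists>c a b B t0. 0 \<le> B \<and> (\<forall>t. p t = c + a * cos t + b * sin t + B * sin (3 * (t - t0)))) \<longleftrightarrow>
      (\<exists>c a b. \<forall>t. p t = c + a * cos t + b * sin t) \<or> parallel_to_steiner_support p" (is "?l \<longleftrightarrow> ?r")
  proof
    assume ?l
    then obtain c a b B t0 where "0 \<le> B" and
      p: "\<forall>t. p t = c + a * cos t + b * sin t + B * sin (3 * (t - t0))" by blast
    show ?r
    proof (cases "B = 0")
      case True
      with p show ?thesis by auto
    next
      case False
      with \<open>0 \<le> B\<close> have "B > 0" by simp
      with p show ?thesis unfolding parallel_to_steiner_support_def by blast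
    qed
  next
    assume ?r
    then show ?l
    proof
      assume "\<exists>c a b. \<forall>t. p t = c + a * cos t + b * sin t"
      then obtain c a b where "\<forall>t. p t = c + a * cos t + b * sin t + 0 * sin (3 * (t - 0))" by auto
      then show ?l by blast
    next
      assume "parallel_to_steiner_support p"
      then show ?l unfolding parallel_to_steiner_support_def by (meson less_imp_le)
    qed
  qed
  then have "W.deficit = 0 \<longleftrightarrow> is_disk K \<or> bounded_by_parallel_to_steiner_curve K"
    unfolding W.deficit_eq_0_iff is_disk_iff bounded_by_parallel_to_steiner_curve_def p_def[symmetric] .
  with key show ?thesis by simp
qed

end
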